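(* Let $G$ range over input graphs with $n$ vertices, chromatic number $O(1)$ (i.e., at most some fixed constant) and maximum degree $o\!\left(\frac{n}{\log n}\right)$, and let $I$ be the initial independent set of $G$. Then \textsc{Independent Set Reconfiguration} under $k$-$\mathsf{TJ}$ is in $\mathsf{NP}$ when $k=|I|-\mu\geq 1$, for any non-negative integer $\mu$ that is at most $O(\log |I|)$.
   Context: All graphs are finite, simple and undirected. For two vertex subsets $A,B$ of a graph $G$ with $|A|=|B|$, $A$ and $B$ are adjacent under $k$-Token Jumping ($k$-$\mathsf{TJ}$) if $|A\triangle B|\le 2k$, where $\triangle$ denotes symmetric difference. \textsc{Independent Set Reconfiguration} (ISR) under $k$-$\mathsf{TJ}$: given a graph $G$ and two independent sets $I,J$ of $G$ with $|I|=|J|$, decide whether there is a sequence $I=I_0,I_1,\dots,I_\ell=J$ of independent sets of $G$ such that $I_{i-1}$ and $I_i$ are adjacent under $k$-$\mathsf{TJ}$ for every $i\in\{1,\dots,\ell\}$. The chromatic number of $G$ is the least $c$ such that $G$ admits a proper vertex coloring with $c$ colors. *)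

theory Defs
  imports Complex_Main "HOL-Library.Landau_Symbols" "HOL-Computational_Algebra.Polynomial"
begin

section \<open>Graphs\<close>

definition simple_graph :: "'a set \<Rightarrow> 'a set set \<Rightarrow> bool" where
  "simple_graph V E \<longleftrightarrow> finite V \<and> E \<subseteq> {{u, v} | u v. u \<in> V \<and> v \<in> V \<and> u \<noteq> v}"

definition indep_set :: "'a set \<Rightarrow> 'a set set \<Rightarrow> 'a set \<Rightarrow> bool" where
  "indep_set V E A \<longleftrightarrow> A \<subseteq> V \<and> (\<forall>u\<in>A. \<forall>v\<in>A. {u, v} \<notin> E)"

definition proper_coloring :: "'a set \<Rightarrow> 'a set set \<Rightarrow> nat \<Rightarrow> ('a \<Rightarrow> nat) \<Rightarrow> bool" where
  "proper_coloring V E c f \<longleftrightarrow>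
     (\<forall>v\<in>V. f v < c) \<and> (\<forall>u\<in>V. \<forall>v\<in>V. {u, v} \<in> E \<longrightarrow> f u \<noteq> f v)"

definition chromatic_number :: "'a set \<Rightarrow> 'a set set \<Rightarrow> nat" where
  "chromatic_number V E = (LEAST c. \<exists>f. proper_coloring V E c f)"

definition degree_in :: "'a set set \<Rightarrow> 'a \<Rightarrow> nat" where
  "degree_in E v = card {e \<in> E. v \<in> e}"

(* The inserted 0 only matters for the graph without vertices. *)
definition max_degree :: "'a set \<Rightarrow> 'a set set \<Rightarrow> nat" where
  "max_degree V E = Max (insert 0 (degree_in E ` V))"


section \<open>Token Jumping\<close>

definition TJ_adjacent :: "nat \<Rightarrow> 'a set \<Rightarrow> 'a set \<Rightarrow> bool" where
  "TJ_adjacent k A B \<longleftrightarrow> card A = card B \<and> card (sym_diff A B) \<le> 2 * k"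

definition TJ_reconfigurable ::
    "'a set \<Rightarrow> 'a set set \<Rightarrow> nat \<Rightarrow> 'a set \<Rightarrow> 'a set \<Rightarrow> bool" where
  "TJ_reconfigurable V E k I J \<longleftrightarrow>
     (\<exists>l (S :: nat \<Rightarrow> 'a set). S 0 = I \<and> S l = J \<and>
        (\<forall>i\<le>l. indep_set V E (S i)) \<and>
        (\<forall>i\<in>{1..l}. TJ_adjacent k (S (i - 1)) (S i)))"


section \<open>Turing machines and NP\<close>

(* Deterministic multitape machines with two-way infinite tapes. States and tape symbols
   are natural numbers below the given bounds. State 0 is initial, 1 accepting and
   2 rejecting; symbol 0 is the blank, 1 and 2 stand for the input bits False and True. *)

datatype dir = Go_Left | Stay | Go_Right

record tm =
  num_tapes :: nat
  num_states :: nat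
  num_symbols :: nat
  transition :: "nat \<Rightarrow> nat list \<Rightarrow> nat \<times> (nat \<times> dir) list"

definition wf_tm :: "tm \<Rightarrow> bool" where
  "wf_tm M \<longleftrightarrow> 2 \<le> num_tapes M \<and> 3 \<le> num_states M \<and> 3 \<le> num_symbols M \<and>
     (\<forall>q < num_states M. \<forall>ss. length ss = num_tapes M \<and> set ss \<subseteq> {..<num_symbols M} \<longrightarrow>
        (case transition M q ss of (q', as) \<Rightarrow>
           q' < num_states M \<and> length as = num_tapes M \<and> fst ` set as \<subseteq> {..<num_symbols M}))"

(* A tape is paired with its head position. *)
type_synonym tape = "int \<times> (int \<Rightarrow> nat)"
type_synonym config = "nat \<times> tape list"

fun offset :: "dir \<Rightarrow> int" where
  "offset Go_Left = -1"
| "offset Stay = 0"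
| "offset Go_Right = 1"

fun act :: "nat \<times> dir \<Rightarrow> tape \<Rightarrow> tape" where
  "act (a, m) (h, t) = (h + offset m, t(h := a))"

fun step :: "tm \<Rightarrow> config \<Rightarrow> config" where
  "step M (q, ts) =
     (if q \<in> {1, 2} then (q, ts)
      else case transition M q (map (\<lambda>(h, t). t h) ts) of (q', as) \<Rightarrow> (q', map2 act as ts))"

definition input_tape :: "bool list \<Rightarrow> tape" where
  "input_tape x =
     (0, \<lambda>i. if 0 \<le> i \<and> i < int (length x) then (if x ! nat i then 2 else 1) else 0)"

(* The input is on the first tape, the certificate on the second one. *)
definition init_config :: "tm \<Rightarrow> bool list \<Rightarrow> bool list \<Rightarrow> config" where
  "init_config M x u =
     (0, input_tape x # input_tape u # replicate (num_tapes M - 2) (input_tape []))"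

definition halts_within :: "tm \<Rightarrow> bool list \<Rightarrow> bool list \<Rightarrow> nat \<Rightarrow> bool" where
  "halts_within M x u T \<longleftrightarrow> fst ((step M ^^ T) (init_config M x u)) \<in> {1, 2}"

definition accepts :: "tm \<Rightarrow> bool list \<Rightarrow> bool list \<Rightarrow> bool" where
  "accepts M x u \<longleftrightarrow> (\<exists>T. fst ((step M ^^ T) (init_config M x u)) = 1)"

definition NP :: "bool list set set" where
  "NP = {L. \<exists>M (p :: nat poly) (q :: nat poly). wf_tm M \<and>
          (\<forall>x u. halts_within M x u (poly q (length x + length u))) \<and>
          (\<forall>x. x \<in> L \<longleftrightarrow> (\<exists>u. length u \<le> poly p (length x) \<and> accepts M x u))}"

(* Membership in NP of the decision problem with instances D and yes-instances those
   satisfying P, as a promise problem: no condition on strings not encoding an element of D. *)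
definition problem_in_NP :: "('i \<Rightarrow> bool list) \<Rightarrow> 'i set \<Rightarrow> ('i \<Rightarrow> bool) \<Rightarrow> bool" where
  "problem_in_NP enc D P \<longleftrightarrow> (\<exists>L \<in> NP. \<forall>x \<in> D. enc x \<in> L \<longleftrightarrow> P x)"


section \<open>Independent Set Reconfiguration\<close>

(* Input graphs have vertex set {..<n}; the number k of simultaneous jumps is part of
   the input. *)
record isr =
  nverts :: nat
  edges :: "nat set set"
  source :: "nat set"
  target :: "nat set"
  jumps :: nat

abbreviation verts :: "isr \<Rightarrow> nat set" where
  "verts X \<equiv> {..<nverts X}"

definition isr_instance :: "isr \<Rightarrow> bool" where
  "isr_instance X \<longleftrightarrow> simple_graph (verts X) (edges X) \<and>
     indep_set (verts X) (edges X) (source X) \<and> indep_set (verts X) (edges X) (target X) \<and>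
     card (source X) = card (target X)"

definition isr_yes :: "isr \<Rightarrow> bool" where
  "isr_yes X \<longleftrightarrow> TJ_reconfigurable (verts X) (edges X) (jumps X) (source X) (target X)"

definition unary :: "nat \<Rightarrow> bool list" where
  "unary m = replicate m True @ [False]"

(* n and k in unary, the adjacency matrix row by row, and the characteristic vectors of
   the two sets. Unary numbers are harmless, as the instances of interest have k \<le> n. *)
definition isr_encode :: "isr \<Rightarrow> bool list" where
  "isr_encode X = unary (nverts X) @ unary (jumps X) @
     [{u, v} \<in> edges X. u \<leftarrow> [0..<nverts X], v \<leftarrow> [0..<nverts X]] @
     [v \<in> source X. v \<leftarrow> [0..<nverts X]] @
     [v \<in> target X. v \<leftarrow> [0..<nverts X]]"

end

(* With k = |I| - mu, two sets of size |I| are adjacent iff they share at least mu tokens. On all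
   instances in question a yes-answer has a witnessing sequence of constant length:
   - if |I| is at most n / (2 (c + 1)), the closed neighbourhood of mu tokens of I and mu tokens
     of J covers at most half of the graph, so a colour class outside it yields an independent
     set K with at least |I| vertices; keep mu tokens of I, move the rest into K, and leave for J
     in the same way;
   - if |I| is larger, sets at distance at least two in a shortest sequence share fewer than mu
     tokens, and n vertices have room for only a bounded number of such large sets;
   - the finitely many remaining n are covered by the number of subsets.
   The verifier checks a sequence given as consecutive blocks of n bits. It is written in a while
   language over tape heads. After copying the input and the certificate to one tape per
   head it only moves heads: the unary n at the start of the input is the ruler of its loops, and
   failures are recorded by moving the head of tape 7 off a mark. *)

theory Submission
  imports Defs "HOL-Real_Asymp.Real_Asymp"
begin

section \<open>Short reconfiguration sequences\<close>

text \<open>A single jump may relocate all but mu tokens, so only these mu tokens need further work.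
  One jump moves them if mu <= k. Otherwise |I| < 2 mu, and as mu is logarithmic in |I| this leaves
  boundedly many values of mu; \<open>mu\<close> jumps then suffice because k >= 1. The degree bound
  makes 2 mu closed neighbourhoods negligible against n, and the factor 2 (c + 1) leaves, in the
  other half of the graph, room for |I| vertices of one colour. Stationary steps pad all sequences
  to one common length, so certificates have linear size.

  The obstacle on the machine side is that \<open>NP\<close> demands halting in time on every pair
  of strings. The invariants therefore assume only what every string has: two unary prefixes that
  can be read off it. Freezing the tapes after copying reduces the state of the program logic to
  head positions, that is, to integer arithmetic. The flag head only moves left, so it never returns
  to its mark and failures need no branching.\<close>

definition TJ_rel :: "'a set \<Rightarrow> 'a set set \<Rightarrow> nat \<Rightarrow> ('a set \<times> 'a set) set" where
  "TJ_rel V E k = {(A, B). indep_set V E A \<and> indep_set V E B \<and> TJ_adjacent k A B}"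

text \<open>Independence of \<open>I\<close> matters for the empty sequence: reflexivity of the
  closure says nothing about \<open>I\<close>, while a sequence of length 0 must consist of an
  independent set.\<close>

lemma TJ_reconfigurable_iff:
  assumes "indep_set V E I"
  shows "TJ_reconfigurable V E k I J \<longleftrightarrow> (I, J) \<in> (TJ_rel V E k)\<^sup>*"
proof
  assume "TJ_reconfigurable V E k I J"
  then show "(I, J) \<in> (TJ_rel V E k)\<^sup>*"
    unfolding TJ_reconfigurable_def
  proof (elim exE conjE)
    fix l :: nat and S :: "nat \<Rightarrow> 'a set"
    assume S: "S 0 = I" "S l = J" "\<forall>i\<le>l. indep_set V E (S i)"
      "\<forall>i\<in>{1..l}. TJ_adjacent k (S (i - 1)) (S i)"
    have "(S i, S (Suc i)) \<in> TJ_rel V E k" if "i < l" for i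
      using S(3) bspec[OF S(4), of "Suc i"] that by (auto simp: TJ_rel_def)
    then have "(S 0, S l) \<in> TJ_rel V E k ^^ l"
      unfolding relpow_fun_conv by blast
    then show ?thesis
      using S by (auto intro: relpow_imp_rtrancl)
  qed
next
  assume "(I, J) \<in> (TJ_rel V E k)\<^sup>*"
  then obtain l where "(I, J) \<in> TJ_rel V E k ^^ l"
    by (auto simp: rtrancl_power)
  then obtain S where S: "S 0 = I" "S l = J" "\<forall>i<l. (S i, S (Suc i)) \<in> TJ_rel V E k"
    unfolding relpow_fun_conv by blast
  have "indep_set V E (S i)" if "i \<le> l" for i
    using S assms that by (cases i) (auto simp: TJ_rel_def)
  moreover have "TJ_adjacent k (S (i - 1)) (S i)" if "i \<in> {1..l}" for i
    using S(3)[rule_format, of "i - 1"] that by (auto simp: TJ_rel_def)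
  ultimately show "TJ_reconfigurable V E k I J"
    unfolding TJ_reconfigurable_def using S by (intro exI[of _ l] exI[of _ S]) auto
qed

lemma indep_set_subset: "indep_set V E A \<Longrightarrow> B \<subseteq> A \<Longrightarrow> indep_set V E B"
  by (auto simp: indep_set_def)

lemma TJ_adjacent_iff_card_Diff:
  assumes "finite A" "finite B" "card A = card B"
  shows "TJ_adjacent k A B \<longleftrightarrow> card (A - B) \<le> k"
proof -
  have "card (sym_diff A B) = card (A - B) + card (B - A)"
    by (rule card_Un_disjoint) (use assms in auto)
  moreover have "card (A - B) = card (B - A)"
    using assms by (simp add: card_Diff_subset_Int Int_commute)
  ultimately show ?thesis
    using assms(3) by (auto simp: TJ_adjacent_def)
qed

text \<open>The form in which k = |I| - mu is used: between sets of size \<open>k + m\<close>, any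
  change that preserves \<open>m\<close> tokens is a single step.\<close>

lemma TJ_adjacent_iff_card_Int:
  assumes "finite A" "finite B" "card A = card B" "card A = k + m"
  shows "TJ_adjacent k A B \<longleftrightarrow> m \<le> card (A \<inter> B)"
proof -
  have "card A = card (A \<inter> B) + card (A - B)"
    using assms(1) card_mono[of A "A \<inter> B"] by (simp add: card_Diff_subset_Int)
  then show ?thesis
    unfolding TJ_adjacent_iff_card_Diff[OF assms(1-3)] using assms(4) by arith
qed

text \<open>A set is adjacent to itself, so sequences can be padded at the end; this gives all
  certificates the same number of blocks.\<close>

lemma TJ_rel_relpow_mono:
  assumes "(A, B) \<in> TJ_rel V E k ^^ i" "i \<le> j" "indep_set V E B"
  shows "(A, B) \<in> TJ_rel V E k ^^ j"
proof -
  have "(B, B) \<in> TJ_rel V E k"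
    using assms(3) by (auto simp: TJ_rel_def TJ_adjacent_def)
  then have "(B, B) \<in> TJ_rel V E k ^^ (j - i)"
    unfolding relpow_fun_conv by (intro exI[of _ "\<lambda>_. B"]) auto
  then have "(A, B) \<in> TJ_rel V E k ^^ (i + (j - i))"
    using assms(1) by (auto simp: relpow_add)
  then show ?thesis
    using assms(2) by simp
qed

text \<open>Inside one independent set \<open>W\<close> every intermediate set is independent, so
  tokens of \<open>A - B\<close> are exchanged greedily for vertices of \<open>B - A\<close>, at
  most \<open>k\<close> in each round.\<close>

lemma swap_tokens:
  assumes "indep_set V E W" "finite V" "A \<subseteq> W" "B \<subseteq> W" "card A = card B"
    and "card (A - B) \<le> k * t"
  shows "(A, B) \<in> TJ_rel V E k ^^ t"
  using assms(3-6)
proof (induction t arbitrary: A)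
  case 0
  have fin: "finite A" "finite B"
    using assms 0 by (meson finite_subset indep_set_def)+
  then have "A \<subseteq> B"
    using 0 by auto
  then have "A = B"
    using 0 fin by (simp add: card_subset_eq)
  then show ?case
    by simp
next
  case (Suc t)
  have fin: "finite W" "finite A" "finite B"
    using assms(1,2) Suc by (meson finite_subset indep_set_def)+
  have eq: "card (A - B) = card (B - A)"
    using fin Suc.prems(3) by (simp add: card_Diff_subset_Int Int_commute)
  define m where "m = min k (card (A - B))"
  obtain A' where A': "A' \<subseteq> A - B" "card A' = m"
    by (metis m_def min.cobounded2 obtain_subset_with_card_n)
  obtain B' where B': "B' \<subseteq> B - A" "card B' = m"
    by (metis m_def eq min.cobounded2 obtain_subset_with_card_n)
  have fin': "finite A'" "finite B'"
    using A' B' fin by (meson finite_Diff finite_subset)+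
  define C where "C = (A - A') \<union> B'"
  have "card C = card (A - A') + card B'"
    unfolding C_def by (rule card_Un_disjoint) (use fin fin' A' B' in auto)
  also have "\<dots> = card A"
  proof -
    have "A' \<subseteq> A"
      using A' by blast
    then show ?thesis
      using A' B' fin fin' card_mono[of A A'] by (simp add: card_Diff_subset)
  qed
  finally have C: "card C = card A" .
  have "A - C = A'"
    using A' B' by (auto simp: C_def)
  then have "TJ_adjacent k A C"
    using A' C fin fin' by (subst TJ_adjacent_iff_card_Diff) (auto simp: C_def m_def)
  moreover have "C \<subseteq> W"
    using A' B' Suc by (auto simp: C_def)
  ultimately have 1: "(A, C) \<in> TJ_rel V E k"
    using Suc assms(1) by (auto simp: TJ_rel_def intro: indep_set_subset)
  have "C - B = (A - B) - A'"
    using A' B' by (auto simp: C_def)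
  then have "card (C - B) = card (A - B) - m"
    using A' fin' by (simp add: card_Diff_subset)
  then have "card (C - B) \<le> k * t"
    using Suc.prems(4) by (auto simp: m_def min_def)
  then have "(C, B) \<in> TJ_rel V E k ^^ t"
    using Suc \<open>C \<subseteq> W\<close> C by simp
  then show ?case
    using 1 by (meson relpow_Suc_I2)
qed

section \<open>Large sets: few of them fit with small overlaps\<close>

lemma card_Union_ge:
  fixes A :: "nat \<Rightarrow> 'a set"
  assumes "\<And>i. i < t \<Longrightarrow> finite (A i)" "\<And>i. i < t \<Longrightarrow> s \<le> card (A i)"
    and "\<And>i j. i < j \<Longrightarrow> j < t \<Longrightarrow> card (A i \<inter> A j) \<le> m"
  shows "t * s \<le> card (\<Union>i<t. A i) + t * t * m"
  using assms
proof (induction t)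
  case (Suc t)
  have IH: "t * s \<le> card (\<Union>i<t. A i) + t * t * m"
    using Suc by simp
  let ?U = "\<Union>i<t. A i"
  have fin: "finite ?U" "finite (A t)"
    using Suc by auto
  \<comment> \<open>The new set meets each of the \<open>t\<close> earlier ones in at most
    \<open>m\<close> points; in total this is crudely bounded by \<open>t * t * m\<close>.\<close>
  have "card (?U \<inter> A t) = card (\<Union>i<t. A i \<inter> A t)"
    by (metis Int_UN_distrib2 UN_extend_simps(4))
  also have "\<dots> \<le> (\<Sum>i<t. card (A i \<inter> A t))"
    by (rule card_UN_le) simp
  also have "\<dots> \<le> (\<Sum>i<t. m)"
    by (rule sum_mono) (use Suc in auto)
  finally have "card (?U \<inter> A t) \<le> t * m"
    by simp
  moreover have "card ?U + card (A t) = card (?U \<union> A t) + card (?U \<inter> A t)"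
    by (rule card_Un_Int) (use fin in auto)
  moreover have "(\<Union>i<Suc t. A i) = ?U \<union> A t"
    by (auto simp: less_Suc_eq)
  ultimately show ?case
    using IH Suc.prems(2)[of t] by (simp add: algebra_simps)
qed simp

text \<open>In a shortest sequence, sets two or more steps apart share fewer than \<open>m\<close> tokens.
  Large sets with small pairwise intersections are few, so the length is bounded.\<close>

lemma short_sequence_large_sets:
  assumes "finite V" "indep_set V E I" "(I, J) \<in> (TJ_rel V E k)\<^sup>*"
    and s: "card I = k + m" "card V < 2 * q * card I"
    and m: "16 * q\<^sup>2 * m \<le> card V"
  shows "\<exists>l\<le>8 * q. (I, J) \<in> TJ_rel V E k ^^ l"
proof -
  define l where "l = (LEAST l. (I, J) \<in> TJ_rel V E k ^^ l)"
  have l: "(I, J) \<in> TJ_rel V E k ^^ l" and min: "\<And>l'. (I, J) \<in> TJ_rel V E k ^^ l' \<Longrightarrow> l \<le> l'"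
    using assms(3) unfolding rtrancl_power l_def by (auto intro: LeastI Least_le)
  obtain S where S: "S 0 = I" "S l = J" "\<And>i. i < l \<Longrightarrow> (S i, S (Suc i)) \<in> TJ_rel V E k"
    using l unfolding relpow_fun_conv by blast
  have ind: "indep_set V E (S i)" if "i \<le> l" for i
    using S assms(2) that by (cases i) (auto simp: TJ_rel_def)
  have cd: "card (S i) = card I" if "i \<le> l" for i
    using that
  proof (induction i)
    case (Suc i)
    then show ?case
      using S(3)[of i] by (auto simp: TJ_rel_def TJ_adjacent_def)
  qed (simp add: S)
  have fin: "finite (S i)" if "i \<le> l" for i
    using ind[OF that] assms(1) by (meson finite_subset indep_set_def)
  have path: "(S i, S (i + d)) \<in> TJ_rel V E k ^^ d" if "i + d \<le> l" for i d
    unfolding relpow_fun_conv using S that by (intro exI[of _ "\<lambda>j. S (i + j)"]) auto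
  \<comment> \<open>More than \<open>m\<close> common tokens would allow a direct jump from
    \<open>S i\<close> to \<open>S j\<close>; replacing at least two steps by one contradicts the
    minimality of \<open>l\<close>.\<close>
  have small: "card (S i \<inter> S j) \<le> m" if "i + 2 \<le> j" "j \<le> l" for i j
  proof (rule ccontr)
    assume "\<not> ?thesis"
    then have "(S i, S j) \<in> TJ_rel V E k"
      using that ind[of i] ind[of j] cd[of i] cd[of j] fin[of i] fin[of j] s
      by (auto simp: TJ_rel_def TJ_adjacent_iff_card_Int)
    moreover have "(I, S i) \<in> TJ_rel V E k ^^ i"
      using path[of 0 i] S that by simp
    moreover have "(S j, J) \<in> TJ_rel V E k ^^ (l - j)"
      using path[of j "l - j"] S that by simp
    ultimately have "(I, J) \<in> TJ_rel V E k ^^ (i + 1 + (l - j))"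
      unfolding relpow_add relpow_1 by blast
    from min[OF this] that show False
      by simp
  qed
  have "l \<le> 8 * q"
  proof (rule ccontr)
    assume "\<not> ?thesis"
    \<comment> \<open>Every second set is taken, so any two are at least two steps apart. Their
      sizes add up to more than \<open>2 * card V\<close>, while the overlaps account for at most
      \<open>card V\<close>.\<close>
    then have "4 * q * card I \<le> card (\<Union>i<4 * q. S (2 * i)) + 4 * q * (4 * q) * m"
      by (intro card_Union_ge) (auto simp: fin cd intro!: small)
    also have "card (\<Union>i<4 * q. S (2 * i)) \<le> card V"
    proof (rule card_mono[OF assms(1)])
      have "S (2 * i) \<subseteq> V" if "i < 4 * q" for i
        using ind[of "2 * i"] \<open>\<not> l \<le> 8 * q\<close> that by (auto simp: indep_set_def)
      then show "(\<Union>i<4 * q. S (2 * i)) \<subseteq> V"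
        by blast
    qed
    finally have "4 * q * card I \<le> card V + 16 * q\<^sup>2 * m"
      by (simp add: power2_eq_square algebra_simps)
    then show False
      using m s(2) by simp
  qed
  then show ?thesis
    using l by blast
qed

section \<open>Small sets: a detour through a colour class\<close>

definition closed_nbhd :: "'a set set \<Rightarrow> 'a set \<Rightarrow> 'a set" where
  "closed_nbhd E M = M \<union> {w. \<exists>v\<in>M. {v, w} \<in> E}"

lemma card_closed_nbhd:
  assumes "simple_graph V E" "M \<subseteq> V"
  shows "card (closed_nbhd E M) \<le> card M * (max_degree V E + 1)"
proof -
  have finV: "finite V" and E: "E \<subseteq> {{u, v} | u v. u \<in> V \<and> v \<in> V \<and> u \<noteq> v}"
    using assms by (auto simp: simple_graph_def)
  have "E \<subseteq> Pow V"
    using E by auto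
  then have finE: "finite E"
    using finV by (meson finite_Pow_iff finite_subset)
  have deg: "card {w. {v, w} \<in> E} \<le> max_degree V E" if "v \<in> V" for v
  proof -
    have "card {w. {v, w} \<in> E} \<le> card {e \<in> E. v \<in> e}"
      by (rule card_inj_on_le[of "\<lambda>w. {v, w}"]) (auto simp: inj_on_def doubleton_eq_iff finE)
    also have "\<dots> = degree_in E v"
      by (simp add: degree_in_def)
    also have "\<dots> \<le> max_degree V E"
      unfolding max_degree_def using finV that by (intro Max_ge) auto
    finally show ?thesis .
  qed
  have finM: "finite M"
    using assms finV by (meson finite_subset)
  have "closed_nbhd E M = (\<Union>v\<in>M. insert v {w. {v, w} \<in> E})"
    by (auto simp: closed_nbhd_def)
  then have "card (closed_nbhd E M) \<le> (\<Sum>v\<in>M. card (insert v {w. {v, w} \<in> E}))"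
    by (simp only: card_UN_le finM)
  also have "\<dots> \<le> (\<Sum>v\<in>M. max_degree V E + 1)"
  proof (rule sum_mono)
    fix v assume "v \<in> M"
    then show "card (insert v {w. {v, w} \<in> E}) \<le> max_degree V E + 1"
      using deg[of v] assms card_insert_le_m1[of "max_degree V E + 1" "{w. {v, w} \<in> E}" v] by auto
  qed
  finally show ?thesis
    by simp
qed

text \<open>A \<open>LEAST\<close> is attained only if some colouring exists; as the vertices are
  numbers below \<open>n\<close>, the identity is one.\<close>

lemma proper_coloring_chromatic_number:
  fixes E :: "nat set set"
  assumes "simple_graph {..<n} E"
  shows "\<exists>f. proper_coloring {..<n} E (chromatic_number {..<n} E) f"
proof -
  have "proper_coloring {..<n} E n id"
    using assms by (auto simp: proper_coloring_def simple_graph_def)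
  then show ?thesis
    unfolding chromatic_number_def by (intro LeastI[of "\<lambda>c. \<exists>f. proper_coloring {..<n} E c f"]) blast
qed

lemma proper_coloring_mono:
  assumes "proper_coloring V E c f" "c \<le> c'"
  shows "proper_coloring V E c' f"
  using assms by (auto simp: proper_coloring_def intro: order_less_le_trans)

lemma large_color_class:
  assumes "proper_coloring V E q f" "finite V" "W \<subseteq> V" "q * s \<le> card W" "0 < q"
  shows "\<exists>K. K \<subseteq> W \<and> indep_set V E K \<and> s \<le> card K"
proof -
  have "\<exists>i<q. s \<le> card {v \<in> W. f v = i}"
  proof (rule ccontr)
    assume contr: "\<not> ?thesis"
    have W: "W = (\<Union>i<q. {v \<in> W. f v = i})"
      using assms by (auto simp: proper_coloring_def)
    have "card W \<le> (\<Sum>i<q. card {v \<in> W. f v = i})"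
      by (subst W) (rule card_UN_le, simp)
    also have "\<dots> < (\<Sum>i<q. s)"
      using contr assms(5) by (intro sum_strict_mono) (auto simp: not_le)
    finally show False
      using assms by simp
  qed
  then obtain i where i: "s \<le> card {v \<in> W. f v = i}"
    by (elim exE conjE)
  moreover have "indep_set V E {v \<in> W. f v = i}"
    using assms unfolding proper_coloring_def indep_set_def by fastforce
  ultimately show ?thesis
    by (intro exI[of _ "{v \<in> W. f v = i}"]) simp
qed

text \<open>The route is \<open>I\<close>, \<open>M0 \<union> K'\<close>, \<open>K\<close>,
  \<open>M1 \<union> K'\<close>, \<open>J\<close>, with legs of 1, \<open>t\<close>,
  \<open>t\<close> and 1 steps. The outer legs are single jumps because \<open>m\<close> tokens
  stay. The inner ones are swaps within \<open>M0 \<union> K\<close> and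
  \<open>M1 \<union> K\<close>, which are independent since \<open>K\<close> avoids the closed
  neighbourhoods of \<open>M0\<close> and \<open>M1\<close>.\<close>

lemma short_sequence_small_sets:
  assumes G: "simple_graph V E" and I: "indep_set V E I" and J: "indep_set V E J"
    and col: "proper_coloring V E q f" "0 < q"
    and s: "card I = card J" "card I = k + m" "2 * q * card I \<le> card V"
    and nbhd: "2 * (2 * m * (max_degree V E + 1)) \<le> card V"
    and t: "m \<le> k * t"
  shows "(I, J) \<in> TJ_rel V E k ^^ (2 * t + 2)"
proof -
  have finV: "finite V" and sub: "I \<subseteq> V" "J \<subseteq> V"
    using G I J by (auto simp: simple_graph_def indep_set_def)
  have fin: "finite I" "finite J"
    using finV sub finite_subset by auto
  obtain M0 where M0: "M0 \<subseteq> I" "card M0 = m"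
    using obtain_subset_with_card_n[of m I] s by auto
  obtain M1 where M1: "M1 \<subseteq> J" "card M1 = m"
    using obtain_subset_with_card_n[of m J] s by auto
  have fin': "finite M0" "finite M1"
    using M0 M1 fin finite_subset by auto
  define N where "N = closed_nbhd E (M0 \<union> M1)"
  have "card N \<le> card (M0 \<union> M1) * (max_degree V E + 1)"
    unfolding N_def by (rule card_closed_nbhd[OF G]) (use M0 M1 sub in auto)
  also have "\<dots> \<le> 2 * m * (max_degree V E + 1)"
    using card_Un_le[of M0 M1] M0 M1 by (intro mult_right_mono) auto
  finally have N: "2 * card N \<le> card V"
    using nbhd by simp
  have "q * card I \<le> card (V - N)"
  proof -
    have "N \<subseteq> V"
      using G M0 M1 sub by (force simp: N_def closed_nbhd_def simple_graph_def doubleton_eq_iff)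
    then have "card (V - N) = card V - card N"
      using finV by (simp add: card_Diff_subset finite_subset)
    then show ?thesis
      using N s(3) by simp
  qed
  from large_color_class[OF col(1) finV _ this col(2)]
  obtain K0 where K0: "K0 \<subseteq> V - N" "indep_set V E K0" "card I \<le> card K0"
    by blast
  obtain K where K: "K \<subseteq> K0" "card K = card I"
    using obtain_subset_with_card_n[OF K0(3)] by auto
  \<comment> \<open>This leaves exactly \<open>m\<close> vertices of \<open>K\<close> free: they
    receive the tokens of \<open>M0\<close> and later supply those of \<open>M1\<close>.\<close>
  obtain K' where K': "K' \<subseteq> K" "card K' = k"
    using obtain_subset_with_card_n[of k K] K s by auto
  have finK: "finite K" "finite K'"
    using K K' K0 finV by (meson finite_Diff finite_subset)+
  have indM: "indep_set V E (M \<union> K)" if M: "M = M0 \<or> M = M1" for M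
  proof -
    have 1: "{a, b} \<notin> E" if "a \<in> M" "b \<in> K" for a b
      using that M K K0 unfolding N_def closed_nbhd_def by blast
    moreover have "{b, a} \<notin> E" if "a \<in> M" "b \<in> K" for a b
      using 1[OF that] by (simp add: insert_commute)
    moreover have "indep_set V E M" "indep_set V E K"
      using M M0 M1 I J K K0 indep_set_subset by blast+
    ultimately show ?thesis
      unfolding indep_set_def by blast
  qed
  have indK': "indep_set V E (M \<union> K')" if "M = M0 \<or> M = M1" for M
    by (rule indep_set_subset[OF indM[OF that]]) (use K' in auto)
  have disj: "M \<inter> K = {}" if "M = M0 \<or> M = M1" for M
    using that K K0 unfolding N_def closed_nbhd_def by blast
  have cM: "card (M \<union> K') = card I" "M \<union> K' - K = M" "card (K - (M \<union> K')) = m"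
    if "M = M0 \<or> M = M1" for M
  proof -
    have M: "finite M" "card M = m" "M \<inter> K' = {}" "M \<inter> K = {}"
      using that M0 M1 fin' disj K' by blast+
    show "card (M \<union> K') = card I" "M \<union> K' - K = M"
      using M K' finK s by (auto simp: card_Un_disjoint)
    have "K - (M \<union> K') = K - K'"
      using M by blast
    then show "card (K - (M \<union> K')) = m"
      using K K' finK s by (simp add: card_Diff_subset)
  qed
  have "(I, M0 \<union> K') \<in> TJ_rel V E k"
  proof -
    have "m \<le> card (I \<inter> (M0 \<union> K'))"
      using M0 fin by (metis Int_greatest Un_upper1 card_mono finite_Int)
    then have "TJ_adjacent k I (M0 \<union> K')"
      using fin fin' finK cM s by (subst TJ_adjacent_iff_card_Int[where m = m]) auto
    then show ?thesis
      using I indK'[of M0] unfolding TJ_rel_def by simp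
  qed
  moreover have "(M0 \<union> K', K) \<in> TJ_rel V E k ^^ t"
    by (rule swap_tokens[OF indM[of M0] finV]) (use cM K K' M0 t in auto)
  moreover have "(K, M1 \<union> K') \<in> TJ_rel V E k ^^ t"
    by (rule swap_tokens[OF indM[of M1] finV]) (use cM K K' M1 t in auto)
  moreover have "(M1 \<union> K', J) \<in> TJ_rel V E k"
  proof -
    have "m \<le> card ((M1 \<union> K') \<inter> J)"
      using M1 fin by (metis Int_greatest Un_upper1 card_mono finite_Int)
    then have "TJ_adjacent k (M1 \<union> K') J"
      using fin fin' finK cM s by (subst TJ_adjacent_iff_card_Int[where m = m]) auto
    then show ?thesis
      using J indK'[of M1] unfolding TJ_rel_def by simp
  qed
  ultimately have "(I, J) \<in> TJ_rel V E k ^^ (1 + t + t + 1)"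
    unfolding relpow_add relpow_1 by blast
  then show ?thesis
    by (simp add: mult_2)
qed

section \<open>Asymptotic estimates\<close>

lemma bigo_ln_bound:
  fixes g :: "nat \<Rightarrow> real"
  assumes "g \<in> O(\<lambda>m. ln (real m))"
  shows "\<exists>C>0. \<exists>C'>0. \<forall>m\<ge>1. g m \<le> C * ln (real m) + C'"
proof -
  obtain C where C: "C > 0" "eventually (\<lambda>m. norm (g m) \<le> C * norm (ln (real m))) at_top"
    using assms by (elim landau_o.bigE)
  then obtain m0 where m0: "\<And>m. m \<ge> m0 \<Longrightarrow> norm (g m) \<le> C * norm (ln (real m))"
    by (auto simp: eventually_at_top_linorder)
  \<comment> \<open>The additive constant covers \<open>m < m0\<close>, where the Landau bound says
    nothing; \<open>insert 1\<close> keeps the maximum defined and positive.\<close>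
  define C' where "C' = Max (insert 1 ((\<lambda>m. \<bar>g m\<bar>) ` {..<m0}))"
  have "g m \<le> C * ln (real m) + C'" if "m \<ge> 1" for m
  proof (cases "m < m0")
    case True
    then have "\<bar>g m\<bar> \<le> C'"
      unfolding C'_def by (intro Max_ge) auto
    moreover have "0 \<le> C * ln (real m)"
      using C that by auto
    ultimately show ?thesis
      by linarith
  next
    case False
    then have "\<bar>g m\<bar> \<le> C * \<bar>ln (real m)\<bar>"
      using m0 by simp
    moreover have "1 \<le> C'"
      unfolding C'_def by (intro Max_ge) auto
    moreover have "0 \<le> ln (real m)"
      using that by simp
    ultimately show ?thesis
      by simp
  qed
  moreover have "1 \<le> C'"
    unfolding C'_def by (intro Max_ge) auto
  ultimately show ?thesis
    using C by (intro exI[of _ C] conjI exI[of _ C']) auto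
qed

text \<open>Collects the numerical side conditions of both constructions. From
  \<open>s \<le> n\<close>, \<open>m\<close> is at most logarithmic in \<open>n\<close>. The last
  clause holds because \<open>s < 2 * m\<close> with \<open>m\<close> at most logarithmic in
  \<open>s\<close> leaves only finitely many \<open>s\<close>.\<close>

lemma degree_bounds:
  fixes d g :: "nat \<Rightarrow> real" and q :: nat
  assumes d: "d \<in> o(\<lambda>n. real n / ln (real n))" and g: "g \<in> O(\<lambda>m. ln (real m))"
  shows "\<exists>n0 t0. \<forall>n s m \<Delta>. real m \<le> g s \<longrightarrow> 1 \<le> s \<longrightarrow>
    (n0 \<le> n \<longrightarrow> s \<le> n \<longrightarrow> real \<Delta> \<le> d n \<longrightarrow>
      2 * (2 * m * (\<Delta> + 1)) \<le> n \<and> 16 * q\<^sup>2 * m \<le> n) \<and>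
    (s < 2 * m \<longrightarrow> m \<le> t0)"
proof -
  obtain C C' where C: "C > 0" "C' > 0" and gC: "\<And>m. 1 \<le> m \<Longrightarrow> g m \<le> C * ln (real m) + C'"
    using bigo_ln_bound[OF g] by blast
  \<comment> \<open>Makes the leading term \<open>4 * (C * ln n) * (e * n / ln n)\<close> equal to
    \<open>n / 2\<close>, which leaves \<open>n / 2\<close> for the lower-order terms.\<close>
  define e where "e = 1 / (8 * C)"
  have e: "e > 0"
    using C by (simp add: e_def)
  have "eventually (\<lambda>n. \<bar>d n\<bar> \<le> e * \<bar>real n / ln (real n)\<bar>) at_top"
    using landau_o.smallD[OF d e] by simp
  moreover have "eventually (\<lambda>n::nat. 4 * ((C * ln (real n) + C') * (e * \<bar>real n / ln (real n)\<bar> + 1)) \<le> real n) at_top"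
    using C unfolding e_def by real_asymp
  moreover have "eventually (\<lambda>n::nat. 16 * (real q)\<^sup>2 * (C * ln (real n) + C') \<le> real n) at_top"
  proof (cases "q = 0")
    case False
    then have "real q > 0"
      by simp
    then show ?thesis
      using C by real_asymp
  qed simp
  moreover have "eventually (\<lambda>n::nat. 2 * (C * ln (real n) + C') \<le> real n) at_top"
    using C by real_asymp
  ultimately have "eventually (\<lambda>n::nat. \<bar>d n\<bar> \<le> e * \<bar>real n / ln (real n)\<bar> \<and>
      4 * ((C * ln (real n) + C') * (e * \<bar>real n / ln (real n)\<bar> + 1)) \<le> real n \<and>
      16 * (real q)\<^sup>2 * (C * ln (real n) + C') \<le> real n \<and>
      2 * (C * ln (real n) + C') \<le> real n) at_top"
    by (intro eventually_conj)
  then obtain n0 where n0: "\<And>n. n0 \<le> n \<Longrightarrow> \<bar>d n\<bar> \<le> e * \<bar>real n / ln (real n)\<bar> \<and>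
      4 * ((C * ln (real n) + C') * (e * \<bar>real n / ln (real n)\<bar> + 1)) \<le> real n \<and>
      16 * (real q)\<^sup>2 * (C * ln (real n) + C') \<le> real n \<and>
      2 * (C * ln (real n) + C') \<le> real n"
    unfolding eventually_at_top_linorder by blast
  define t0 where "t0 = nat \<lceil>C * ln (real n0) + C'\<rceil>"
  have large: "2 * (2 * m * (\<Delta> + 1)) \<le> n \<and> 16 * q\<^sup>2 * m \<le> n"
    if m: "real m \<le> g s" "1 \<le> s" "n0 \<le> n" "s \<le> n" "real \<Delta> \<le> d n" for n s m \<Delta> :: nat
  proof -
    have "ln (real s) \<le> ln (real n)"
      using m by simp
    then have "C * ln (real s) \<le> C * ln (real n)"
      using C by simp
    then have mC: "real m \<le> C * ln (real n) + C'"
      using gC[OF m(2)] m(1) by linarith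
    have \<Delta>: "real \<Delta> + 1 \<le> e * \<bar>real n / ln (real n)\<bar> + 1"
      using m(5) n0[OF m(3)] by linarith
    have "real m * (real \<Delta> + 1) \<le> (C * ln (real n) + C') * (e * \<bar>real n / ln (real n)\<bar> + 1)"
      by (rule mult_mono[OF mC \<Delta>]) (use mC in linarith)+
    then have "4 * (real m * (real \<Delta> + 1)) \<le> real n"
      using n0[OF m(3)] by linarith
    then have "real (2 * (2 * m * (\<Delta> + 1))) \<le> real n"
      by (simp add: algebra_simps)
    moreover have "16 * (real q)\<^sup>2 * real m \<le> 16 * (real q)\<^sup>2 * (C * ln (real n) + C')"
      by (rule mult_left_mono[OF mC]) simp
    then have "real (16 * q\<^sup>2 * m) \<le> real n"
      using n0[OF m(3)] by simp
    ultimately show ?thesis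
      unfolding of_nat_le_iff ..
  qed
  have small: "m \<le> t0" if m: "real m \<le> g s" "1 \<le> s" "s < 2 * m" for s m :: nat
  proof -
    have mC: "real m \<le> C * ln (real s) + C'"
      using gC[OF m(2)] m(1) by linarith
    have "s < n0"
    proof (rule ccontr)
      assume "\<not> ?thesis"
      then have "2 * (C * ln (real s) + C') \<le> real s"
        using n0 by simp
      moreover have "real s < real (2 * m)"
        using m(3) by (simp only: of_nat_less_iff)
      ultimately show False
        using mC by simp
    qed
    then have "C * ln (real s) \<le> C * ln (real n0)"
      using C m by simp
    then have "real m \<le> C * ln (real n0) + C'"
      using mC by linarith
    then show ?thesis
      unfolding t0_def by linarith
  qed
  show ?thesis
    using large small by blast
qed

section \<open>A length bound independent of the instance\<close>

lemma short_sequence_card_bound: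
  assumes "finite V" "(I, J) \<in> (TJ_rel V E k)\<^sup>*"
  shows "\<exists>l\<le>4 ^ card V. (I, J) \<in> TJ_rel V E k ^^ l"
proof -
  have sub: "TJ_rel V E k \<subseteq> Pow V \<times> Pow V"
    by (auto simp: TJ_rel_def indep_set_def)
  have fin: "finite (Pow V \<times> Pow V)"
    using assms by simp
  \<comment> \<open>A path in a finite relation need not be longer than the number of its pairs. The
    resulting bound is exponential, but it is applied only for \<open>n < n0\<close>.\<close>
  then have "(I, J) \<in> (\<Union>n\<in>{n. n \<le> card (TJ_rel V E k)}. TJ_rel V E k ^^ n)"
    using assms(2) rtrancl_finite_eq_relpow sub finite_subset by metis
  then obtain l where l: "l \<le> card (TJ_rel V E k)" "(I, J) \<in> TJ_rel V E k ^^ l"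
    by auto
  have "card (TJ_rel V E k) \<le> card (Pow V \<times> Pow V)"
    by (rule card_mono[OF fin sub])
  also have "\<dots> = 2 ^ card V * 2 ^ card V"
    using assms by (simp add: card_Pow card_cartesian_product)
  also have "\<dots> = (4::nat) ^ card V"
    by (simp flip: power_mult_distrib)
  finally have "l \<le> 4 ^ card V"
    using l by linarith
  then show ?thesis
    using l by blast
qed

text \<open>The order of quantifiers is the point: \<open>l0\<close> depends on \<open>c\<close>,
  \<open>d\<close> and \<open>g\<close> only.\<close>

lemma short_sequence:
  fixes c :: nat and d g :: "nat \<Rightarrow> real"
  assumes d: "d \<in> o(\<lambda>n. real n / ln (real n))" and g: "g \<in> O(\<lambda>m. ln (real m))"
  shows "\<exists>l0. \<forall>n E I J k \<mu>. simple_graph {..<n} E \<longrightarrow> chromatic_number {..<n} E \<le> c \<longrightarrow>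
    real (max_degree {..<n} E) \<le> d n \<longrightarrow> indep_set {..<n} E I \<longrightarrow> indep_set {..<n} E J \<longrightarrow>
    card I = card J \<longrightarrow> real \<mu> \<le> g (card I) \<longrightarrow> card I = k + \<mu> \<longrightarrow> 1 \<le> k \<longrightarrow>
    TJ_reconfigurable {..<n} E k I J \<longrightarrow> (I, J) \<in> TJ_rel {..<n} E k ^^ l0"
proof -
  \<comment> \<open>The successor keeps the number of colours positive even for
    \<open>c = 0\<close>.\<close>
  define q where "q = Suc c"
  obtain n0 t0 where bounds: "\<And>n s m \<Delta>. real m \<le> g s \<Longrightarrow> 1 \<le> s \<Longrightarrow>
      (n0 \<le> n \<longrightarrow> s \<le> n \<longrightarrow> real \<Delta> \<le> d n \<longrightarrow>
      2 * (2 * m * (\<Delta> + 1)) \<le> n \<and> 16 * q\<^sup>2 * m \<le> n) \<and> (s < 2 * m \<longrightarrow> m \<le> t0)"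
    using degree_bounds[OF d g, of q] by meson
  define l0 where "l0 = 4 ^ n0 + 8 * q + (2 * (t0 + 1) + 2)"
  have "(I, J) \<in> TJ_rel {..<n} E k ^^ l0"
    if G: "simple_graph {..<n} E" "chromatic_number {..<n} E \<le> c"
      "real (max_degree {..<n} E) \<le> d n" and IJ: "indep_set {..<n} E I" "indep_set {..<n} E J"
      "card I = card J" and \<mu>: "real \<mu> \<le> g (card I)" "card I = k + \<mu>" "1 \<le> k"
      and yes: "TJ_reconfigurable {..<n} E k I J" for n E I J k \<mu>
  proof -
    have r: "(I, J) \<in> (TJ_rel {..<n} E k)\<^sup>*"
      using yes TJ_reconfigurable_iff[OF IJ(1)] by blast
    have In: "card I \<le> n"
      using IJ(1) card_mono[of "{..<n}" I] by (auto simp: indep_set_def)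
    have "\<exists>l\<le>l0. (I, J) \<in> TJ_rel {..<n} E k ^^ l"
    proof (cases "n < n0")
      case True
      have "(4::nat) ^ n \<le> 4 ^ n0"
        using True by (intro power_increasing) auto
      then have "4 ^ n \<le> l0"
        unfolding l0_def by linarith
      moreover obtain l where "l \<le> 4 ^ n" "(I, J) \<in> TJ_rel {..<n} E k ^^ l"
        using short_sequence_card_bound[OF _ r] by auto
      ultimately show ?thesis
        by (intro exI[of _ l]) auto
    next
      case False
      then have b: "2 * (2 * \<mu> * (max_degree {..<n} E + 1)) \<le> n" "16 * q\<^sup>2 * \<mu> \<le> n"
        using bounds[OF \<mu>(1), of n "max_degree {..<n} E"] \<mu> In G(3) by auto
      show ?thesis
      proof (cases "2 * q * card I \<le> n")
        case True
        obtain f where f: "proper_coloring {..<n} E (chromatic_number {..<n} E) f"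
          using proper_coloring_chromatic_number[OF G(1)] by blast
        then have f: "proper_coloring {..<n} E q f"
          by (rule proper_coloring_mono) (use G(2) in \<open>simp add: q_def\<close>)
        \<comment> \<open>If \<open>k < \<mu>\<close>, then \<open>\<mu> \<le> k * \<mu>\<close> by
          \<open>1 \<le> k\<close>, and \<open>card I < 2 * \<mu>\<close> gives
          \<open>\<mu> \<le> t0\<close>.\<close>
        define t where "t = (if \<mu> \<le> k then 1 else \<mu>)"
        have "\<mu> \<le> t0" if "k < \<mu>"
          using bounds[OF \<mu>(1)] \<mu> that by auto
        then have t: "\<mu> \<le> k * t" "t \<le> t0 + 1"
          using \<mu>(3) by (auto simp: t_def)
        have "(I, J) \<in> TJ_rel {..<n} E k ^^ (2 * t + 2)"
          by (rule short_sequence_small_sets[OF G(1) IJ(1,2) f _ IJ(3) \<mu>(2)])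
            (use True b t in \<open>auto simp: q_def\<close>)
        then show ?thesis
          using t(2) unfolding l0_def by (intro exI[of _ "2 * t + 2"]) auto
      next
        case False
        have "\<exists>l\<le>8 * q. (I, J) \<in> TJ_rel {..<n} E k ^^ l"
          by (rule short_sequence_large_sets[OF _ IJ(1) r \<mu>(2)]) (use False b in auto)
        moreover have "8 * q \<le> l0"
          unfolding l0_def by simp
        ultimately show ?thesis
          by (meson order_trans)
      qed
    qed
    then show ?thesis
      using TJ_rel_relpow_mono IJ(2) by blast
  qed
  then show ?thesis
    by blast
qed

section \<open>While programs on Turing machines\<close>

text \<open>\<open>Act\<close> is one machine step: from the symbols under all heads it prescribes a
  symbol and a move for each tape. Functions on tape numbers replace the lists of the machine model,
  so programs carry no length conditions.\<close>

datatype com =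
    Act "(nat \<Rightarrow> nat) \<Rightarrow> nat \<Rightarrow> nat \<times> dir"
  | Seq com com (infixr ";;" 60)
  | While "(nat \<Rightarrow> nat) \<Rightarrow> bool" com

definition reads :: "nat \<Rightarrow> (nat \<Rightarrow> int) \<Rightarrow> (nat \<Rightarrow> int \<Rightarrow> nat) \<Rightarrow> nat \<Rightarrow> nat" where
  "reads K h T i = (if i < K then T i (h i) else 0)"

text \<open>Big-step semantics with the exact number of machine steps, one for each loop test. Heads
  numbered \<open>K\<close> or higher may move too; \<open>conf\<close> forgets them.\<close>

inductive exec :: "nat \<Rightarrow> com \<Rightarrow> (nat \<Rightarrow> int) \<Rightarrow> (nat \<Rightarrow> int \<Rightarrow> nat) \<Rightarrow> nat \<Rightarrow>
    (nat \<Rightarrow> int) \<Rightarrow> (nat \<Rightarrow> int \<Rightarrow> nat) \<Rightarrow> bool" for K where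
  exec_Act: "exec K (Act f) h T 1 (\<lambda>i. h i + offset (snd (f (reads K h T) i)))
    (\<lambda>i. if i < K then (T i)(h i := fst (f (reads K h T) i)) else T i)"
| exec_Seq: "exec K c1 h T t1 h1 T1 \<Longrightarrow> exec K c2 h1 T1 t2 h2 T2 \<Longrightarrow>
    exec K (c1 ;; c2) h T (t1 + t2) h2 T2"
| exec_While_False: "\<not> b (reads K h T) \<Longrightarrow> exec K (While b c) h T 1 h T"
| exec_While_True: "b (reads K h T) \<Longrightarrow> exec K c h T t1 h1 T1 \<Longrightarrow>
    exec K (While b c) h1 T1 t2 h2 T2 \<Longrightarrow> exec K (While b c) h T (1 + t1 + t2) h2 T2"

section \<open>Compilation to a Turing machine\<close>

fun com_size :: "com \<Rightarrow> nat" where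
  "com_size (Act f) = 1"
| "com_size (c1 ;; c2) = com_size c1 + com_size c2"
| "com_size (While b c) = 1 + com_size c"

definition stay :: "nat \<Rightarrow> (nat \<Rightarrow> nat) \<Rightarrow> (nat \<times> dir) list" where
  "stay K r = map (\<lambda>i. (r i, Stay)) [0..<K]"

text \<open>The code of \<open>c\<close> occupies the states from \<open>s\<close> to \<open>s + com_size c - 1\<close>, is entered at \<open>s\<close>
  and left to \<open>e\<close>.\<close>

fun code_trans :: "nat \<Rightarrow> com \<Rightarrow> nat \<Rightarrow> nat \<Rightarrow> nat \<Rightarrow> (nat \<Rightarrow> nat) \<Rightarrow> nat \<times> (nat \<times> dir) list" where
  "code_trans K (Act f) s e q r = (e, map (f r) [0..<K])"
| "code_trans K (c1 ;; c2) s e q r =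
    (if q < s + com_size c1 then code_trans K c1 s (s + com_size c1) q r
     else code_trans K c2 (s + com_size c1) e q r)"
| "code_trans K (While b c) s e q r =
    (if q = s then (if b r then s + 1 else e, stay K r) else code_trans K c (s + 1) s q r)"

definition conf :: "nat \<Rightarrow> nat \<Rightarrow> (nat \<Rightarrow> int) \<Rightarrow> (nat \<Rightarrow> int \<Rightarrow> nat) \<Rightarrow> config" where
  "conf K q h T = (q, map (\<lambda>i. (h i, T i)) [0..<K])"

definition lookup :: "nat list \<Rightarrow> nat \<Rightarrow> nat" where
  "lookup ss i = (if i < length ss then ss ! i else 0)"

text \<open>States 0, 1 and 2 have a fixed meaning, so the code starts at 3; the state after the
  code decides by \<open>acc\<close>.\<close>

definition machine :: "nat \<Rightarrow> nat \<Rightarrow> com \<Rightarrow> ((nat \<Rightarrow> nat) \<Rightarrow> bool) \<Rightarrow> tm" where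
  "machine K S c acc = \<lparr>num_tapes = K, num_states = 4 + com_size c, num_symbols = S,
     transition = (\<lambda>q ss.
       if q = 0 then (3, stay K (lookup ss))
       else if 3 \<le> q \<and> q < 3 + com_size c then code_trans K c 3 (3 + com_size c) q (lookup ss)
       else (if acc (lookup ss) then 1 else 2, stay K (lookup ss)))\<rparr>"

lemma com_size_pos: "0 < com_size c"
  by (induction c) auto

lemma step_conf:
  assumes "q \<notin> {1, 2}"
    and "transition M q (map (\<lambda>i. T i (h i)) [0..<K]) = (q', map a [0..<K])"
  shows "step M (conf K q h T) =
    conf K q' (\<lambda>i. h i + offset (snd (a i))) (\<lambda>i. (T i)(h i := fst (a i)))"
proof -
  have "map2 act (map a [0..<K]) (map (\<lambda>i. (h i, T i)) [0..<K]) =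
      map (\<lambda>i. (h i + offset (snd (a i)), (T i)(h i := fst (a i)))) [0..<K]"
    by (rule nth_equalityI) (auto simp: split: prod.splits, metis act.simps prod.collapse)
  then show ?thesis
    using assms by (simp add: conf_def o_def)
qed

lemma lookup_map: "lookup (map (\<lambda>i. T i (h i)) [0..<K]) = reads K h T"
  by (auto simp: lookup_def reads_def)

lemma conf_cong:
  assumes "\<And>i. i < K \<Longrightarrow> h i = h' i" "\<And>i. i < K \<Longrightarrow> T i = T' i"
  shows "conf K q h T = conf K q h' T'"
  using assms by (auto simp: conf_def)

lemma step_stay:
  assumes "q \<notin> {1, 2}"
    and "transition M q (map (\<lambda>i. T i (h i)) [0..<K]) = (q', stay K (reads K h T))"
  shows "step M (conf K q h T) = conf K q' h T"
  using step_conf[where a = "\<lambda>i. (reads K h T i, Stay)" and h = h and T = T and K = K and q' = q',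
      OF assms(1) assms(2)[unfolded stay_def]]
  by (auto simp: reads_def intro: conf_cong)

text \<open>The induction relocates subprograms, hence arbitrary \<open>s\<close> and
  \<open>e\<close> and an assumption on the interval of \<open>c\<close> only.
  \<open>3 \<le> s\<close> keeps clear of the halting states, where \<open>step\<close> does
  nothing.\<close>

lemma exec_code:
  assumes "exec K c h T t h' T'" "3 \<le> s"
    and "\<And>q ss. s \<le> q \<Longrightarrow> q < s + com_size c \<Longrightarrow>
      transition M q ss = code_trans K c s e q (lookup ss)"
  shows "(step M ^^ t) (conf K s h T) = conf K e h' T'"
  using assms
proof (induction arbitrary: s e rule: exec.induct)
  case (exec_Act f h T)
  have "step M (conf K s h T) = conf K e (\<lambda>i. h i + offset (snd (f (reads K h T) i)))
      (\<lambda>i. (T i)(h i := fst (f (reads K h T) i)))"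
    by (rule step_conf) (use exec_Act in \<open>auto simp: lookup_map\<close>)
  also have "\<dots> = conf K e (\<lambda>i. h i + offset (snd (f (reads K h T) i)))
      (\<lambda>i. if i < K then (T i)(h i := fst (f (reads K h T) i)) else T i)"
    by (rule conf_cong) auto
  finally show ?case
    by (simp only: One_nat_def funpow.simps o_apply id_apply)
next
  case (exec_Seq c1 h T t1 h1 T1 c2 t2 h2 T2)
  have "(step M ^^ t1) (conf K s h T) = conf K (s + com_size c1) h1 T1"
    by (rule exec_Seq.IH(1)) (use exec_Seq.prems in auto)
  moreover have "(step M ^^ t2) (conf K (s + com_size c1) h1 T1) = conf K e h2 T2"
    by (rule exec_Seq.IH(2)) (use exec_Seq.prems in auto)
  ultimately show ?case
    by (simp add: add.commute[of t1] funpow_add)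
next
  case (exec_While_False b h T c)
  show ?case
    using exec_While_False by (simp add: step_stay lookup_map)
next
  case (exec_While_True b h T c t1 h1 T1 t2 h2 T2)
  have "step M (conf K s h T) = conf K (s + 1) h T"
    using exec_While_True.hyps(1) exec_While_True.prems by (intro step_stay) (auto simp: lookup_map)
  moreover have "(step M ^^ t1) (conf K (s + 1) h T) = conf K s h1 T1"
    by (rule exec_While_True.IH(1)) (use exec_While_True.prems in auto)
  moreover have "(step M ^^ t2) (conf K s h1 T1) = conf K e h2 T2"
    by (rule exec_While_True.IH(2)) (use exec_While_True.prems in auto)
  moreover have "1 + t1 + t2 = t2 + (t1 + 1)"
    by simp
  ultimately show ?case
    by (simp only: funpow_add o_apply One_nat_def funpow.simps id_apply)
qed

lemma code_trans_wf:
  assumes "s \<le> q" "q < s + com_size c"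
  shows "fst (code_trans K c s e q r) \<in> insert e {s..<s + com_size c} \<and>
    length (snd (code_trans K c s e q r)) = K"
  using assms
proof (induction c arbitrary: s e)
  case (Seq c1 c2)
  show ?case
    using Seq.prems com_size_pos[of c2] Seq.IH(1)[of s "s + com_size c1"]
      Seq.IH(2)[of "s + com_size c1" e]
    by (cases "q < s + com_size c1") auto
next
  case (While b c)
  show ?case
    using While.prems com_size_pos[of c] While.IH[of "s + 1" s]
    by (cases "q = s") (auto simp: stay_def)
qed simp

fun com_wf :: "nat \<Rightarrow> com \<Rightarrow> bool" where
  "com_wf S (Act f) \<longleftrightarrow> (\<forall>r i. (\<forall>j. r j < S) \<longrightarrow> fst (f r i) < S)"
| "com_wf S (c1 ;; c2) \<longleftrightarrow> com_wf S c1 \<and> com_wf S c2"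
| "com_wf S (While b c) \<longleftrightarrow> com_wf S c"

lemma code_trans_symbols:
  assumes "com_wf S c" "\<forall>j. r j < S"
  shows "fst ` set (snd (code_trans K c s e q r)) \<subseteq> {..<S}"
  using assms by (induction c arbitrary: s e) (auto simp: stay_def)

lemma wf_machine:
  assumes "com_wf S c" "2 \<le> K" "3 \<le> S"
  shows "wf_tm (machine K S c acc)"
proof -
  let ?M = "machine K S c acc"
  have *: "q' < 4 + com_size c \<and> length as = K \<and> fst ` set as \<subseteq> {..<S}"
    if "length ss = K" "set ss \<subseteq> {..<S}" "transition ?M q ss = (q', as)" for q ss q' as
  proof -
    have S: "\<forall>j. lookup ss j < S"
      using that(1,2) assms(3) by (auto simp: lookup_def subset_iff)
    show ?thesis
    proof (cases "3 \<le> q \<and> q < 3 + com_size c")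
      case True
      then have "(q', as) = code_trans K c 3 (3 + com_size c) q (lookup ss)"
        using that(3) by (simp add: machine_def)
      then show ?thesis
        using True code_trans_symbols[OF assms(1) S, of K 3 "3 + com_size c" q]
          code_trans_wf[of 3 q c K "3 + com_size c" "lookup ss"]
        by (auto simp: prod_eq_iff)
    next
      case False
      then show ?thesis
        using that(3) S by (auto simp: machine_def stay_def split: if_splits)
    qed
  qed
  have "num_tapes ?M = K" "num_states ?M = 4 + com_size c" "num_symbols ?M = S"
    by (simp_all add: machine_def)
  then show ?thesis
    unfolding wf_tm_def using assms(2,3) * by (fastforce split: prod.split)
qed

section \<open>Runs of the compiled machine and membership in NP\<close>

definition init_tapes :: "bool list \<Rightarrow> bool list \<Rightarrow> nat \<Rightarrow> int \<Rightarrow> nat" where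
  "init_tapes x u i = snd (input_tape (if i = 0 then x else if i = 1 then u else []))"

lemma init_config_machine:
  assumes "2 \<le> K"
  shows "init_config (machine K S c acc) x u = conf K 0 (\<lambda>_. 0) (init_tapes x u)"
proof -
  have "[0..<K] = 0 # 1 # [2..<K]"
    using assms by (simp add: upt_conv_Cons numeral_2_eq_2)
  moreover have "map (\<lambda>i. (0::int, init_tapes x u i)) [2..<K] = replicate (K - 2) (input_tape [])"
    by (rule nth_equalityI) (auto simp: init_tapes_def input_tape_def)
  ultimately show ?thesis
    by (auto simp: init_config_def conf_def machine_def init_tapes_def input_tape_def)
qed

text \<open>The two extra steps lead from state 0 into the code and evaluate \<open>acc\<close> at
  its end.\<close>

lemma machine_halts:
  assumes "exec K c (\<lambda>_. 0) (init_tapes x u) t h T" "2 \<le> K"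
  shows "fst ((step (machine K S c acc) ^^ (t + 2)) (init_config (machine K S c acc) x u)) =
    (if acc (reads K h T) then 1 else 2)"
proof -
  let ?M = "machine K S c acc"
  have "step ?M (conf K 0 (\<lambda>_. 0) (init_tapes x u)) = conf K 3 (\<lambda>_. 0) (init_tapes x u)"
    using lookup_map[of "init_tapes x u" "\<lambda>_. 0" K]
    by (intro step_stay) (auto simp: machine_def)
  moreover have "(step ?M ^^ t) (conf K 3 (\<lambda>_. 0) (init_tapes x u)) = conf K (3 + com_size c) h T"
    by (rule exec_code[OF assms(1)]) (auto simp: machine_def)
  moreover have "step ?M (conf K (3 + com_size c) h T) =
      conf K (if acc (reads K h T) then 1 else 2) h T"
    by (intro step_stay) (auto simp: machine_def lookup_map)
  moreover have "t + 2 = 1 + (t + 1)"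
    by simp
  ultimately show ?thesis
    unfolding init_config_machine[OF assms(2)]
    by (simp only: funpow_add o_apply One_nat_def funpow.simps id_apply) (simp add: conf_def)
qed

lemma funpow_step_halted:
  assumes "fst C \<in> {1, 2}"
  shows "(step M ^^ n) C = C"
proof (induction n)
  case (Suc n)
  then show ?case
    using assms by (cases C) auto
qed simp

lemma halted_later:
  assumes "fst ((step M ^^ t) C) \<in> {1, 2}" "t \<le> t'"
  shows "(step M ^^ t') C = (step M ^^ t) C"
proof -
  have "(step M ^^ (t' - t + t)) C = (step M ^^ t) C"
    unfolding funpow_add o_apply by (rule funpow_step_halted[OF assms(1)])
  then show ?thesis
    using assms(2) by simp
qed

lemma accepts_iff:
  assumes "fst ((step M ^^ t) (init_config M x u)) \<in> {1, 2}"
  shows "accepts M x u \<longleftrightarrow> fst ((step M ^^ t) (init_config M x u)) = 1"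
proof
  assume "accepts M x u"
  then obtain t' where t': "fst ((step M ^^ t') (init_config M x u)) = 1"
    by (auto simp: accepts_def)
  show "fst ((step M ^^ t) (init_config M x u)) = 1"
  proof (cases "t \<le> t'")
    case True
    then show ?thesis
      using halted_later[OF assms True] t' by simp
  next
    case False
    then show ?thesis
      using halted_later[where M = M and t = t' and t' = t and C = "init_config M x u"] t' by simp
  qed
qed (auto simp: accepts_def)

lemma machine_accepts:
  assumes "exec K c (\<lambda>_. 0) (init_tapes x u) t h T" "2 \<le> K"
  shows "accepts (machine K S c acc) x u \<longleftrightarrow> acc (reads K h T)"
proof -
  have *: "fst ((step (machine K S c acc) ^^ (t + 2)) (init_config (machine K S c acc) x u)) \<in> {1, 2}"
    unfolding machine_halts[OF assms] by simp
  show ?thesis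
    unfolding accepts_iff[OF *] machine_halts[OF assms] by simp
qed

lemma machine_halts_within:
  assumes "exec K c (\<lambda>_. 0) (init_tapes x u) t h T" "2 \<le> K" "t + 2 \<le> B"
  shows "halts_within (machine K S c acc) x u B"
proof -
  have *: "fst ((step (machine K S c acc) ^^ (t + 2)) (init_config (machine K S c acc) x u)) \<in> {1, 2}"
    unfolding machine_halts[OF assms(1,2)] by simp
  then show ?thesis
    unfolding halts_within_def halted_later[OF * assms(3)] .
qed

text \<open>The run is bounded for all \<open>x\<close> and \<open>u\<close>, malformed ones
  included, since \<open>NP\<close> asks for halting everywhere.\<close>

lemma NP_machine:
  fixes p q :: "nat poly"
  assumes "com_wf S c" "2 \<le> K" "3 \<le> S"
    and exec: "\<And>x u. \<exists>t h T. exec K c (\<lambda>_. 0) (init_tapes x u) t h T \<and>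
      t + 2 \<le> poly q (length x + length u) \<and> (acc (reads K h T) \<longleftrightarrow> P x u)"
  shows "{x. \<exists>u. length u \<le> poly p (length x) \<and> P x u} \<in> NP"
proof -
  have "halts_within (machine K S c acc) x u (poly q (length x + length u)) \<and>
      (accepts (machine K S c acc) x u \<longleftrightarrow> P x u)" for x u
    using exec[of x u] machine_accepts[OF _ assms(2), of c x u _ _ _ S acc]
      machine_halts_within[OF _ assms(2), of c x u] by blast
  then show ?thesis
    using wf_machine[OF assms(1-3), of acc] unfolding NP_def by blast
qed

section \<open>A Hoare logic for programs that only move heads\<close>

text \<open>Writing back what was read keeps the tape contents constant, so they can be a mere
  parameter \<open>T\<close> of the logic.\<close>

definition Mv :: "((nat \<Rightarrow> nat) \<Rightarrow> nat \<Rightarrow> dir) \<Rightarrow> com" where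
  "Mv f = Act (\<lambda>r i. (r i, f r i))"

lemma exec_Mv: "exec K (Mv f) h T 1 (\<lambda>i. h i + offset (f (reads K h T) i)) T"
proof -
  have "(\<lambda>i. if i < K then (T i)(h i := reads K h T i) else T i) = T"
    by (auto simp: reads_def)
  then show ?thesis
    using exec_Act[of K "\<lambda>r i. (r i, f r i)" h T] by (simp only: Mv_def fst_conv snd_conv)
qed

definition Go :: "nat set \<Rightarrow> dir \<Rightarrow> com" where
  "Go A d = Mv (\<lambda>_ i. if i \<in> A then d else Stay)"

text \<open>Repeats \<open>c\<close> once for each leading symbol \<open>2\<close> on tape \<open>i\<close>, then rewinds that tape.\<close>

definition For :: "nat \<Rightarrow> com \<Rightarrow> com" where
  "For i c = While (\<lambda>r. r i = 2) (c ;; Go {i} Go_Right) ;; Go {i} Go_Left ;;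
     While (\<lambda>r. r i = 2) (Go {i} Go_Left) ;; Go {i} Go_Right"

definition hoare :: "nat \<Rightarrow> (nat \<Rightarrow> int \<Rightarrow> nat) \<Rightarrow> ((nat \<Rightarrow> int) \<Rightarrow> bool) \<Rightarrow> com \<Rightarrow> nat \<Rightarrow>
    ((nat \<Rightarrow> int) \<Rightarrow> bool) \<Rightarrow> bool" where
  "hoare K T P c B Q \<longleftrightarrow> (\<forall>h. P h \<longrightarrow> (\<exists>t\<le>B. \<exists>h'. exec K c h T t h' T \<and> Q h'))"

lemma hoare_conseq:
  assumes "hoare K T P c B Q" "\<And>h. P' h \<Longrightarrow> P h" "\<And>h. Q h \<Longrightarrow> Q' h" "B \<le> B'"
  shows "hoare K T P' c B' Q'"
  using assms unfolding hoare_def by (meson order_trans)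

lemma hoare_Mv:
  assumes "\<And>h. P h \<Longrightarrow> Q (\<lambda>i. h i + offset (f (reads K h T) i))"
  shows "hoare K T P (Mv f) 1 Q"
  unfolding hoare_def using assms exec_Mv by blast

lemma hoare_Go:
  assumes "\<And>h. P h \<Longrightarrow> Q (\<lambda>i. h i + (if i \<in> A then offset d else 0))"
  shows "hoare K T P (Go A d) 1 Q"
  unfolding Go_def by (rule hoare_Mv) (use assms in \<open>simp add: if_distrib cong: if_cong\<close>)

lemma hoare_Seq:
  assumes "hoare K T P c1 B1 R" "hoare K T R c2 B2 Q"
  shows "hoare K T P (c1 ;; c2) (B1 + B2) Q"
  unfolding hoare_def
proof (intro allI impI)
  fix h assume "P h"
  then obtain t1 h1 where 1: "t1 \<le> B1" "exec K c1 h T t1 h1 T" "R h1"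
    using assms(1) by (auto simp: hoare_def)
  then obtain t2 h2 where 2: "t2 \<le> B2" "exec K c2 h1 T t2 h2 T" "Q h2"
    using assms(2) by (auto simp: hoare_def)
  show "\<exists>t\<le>B1 + B2. \<exists>h'. exec K (c1 ;; c2) h T t h' T \<and> Q h'"
    using 1 2 exec_Seq[OF 1(2) 2(2)] by (intro exI[of _ "t1 + t2"] conjI exI[of _ h2]) auto
qed

text \<open>The number \<open>N\<close> of iterations is fixed in advance, so the invariant is
  indexed by the iteration and termination needs no measure. Each iteration pays for the body and a
  test, and one failing test follows.\<close>

lemma hoare_While:
  assumes "\<And>j h. j < N \<Longrightarrow> I j h \<Longrightarrow> b (reads K h T)" "\<And>h. I N h \<Longrightarrow> \<not> b (reads K h T)"
    and body: "\<And>j. j < N \<Longrightarrow> hoare K T (I j) c B (I (Suc j))"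
  shows "hoare K T (I 0) (While b c) (N * (B + 1) + 1) (I N)"
proof -
  have "\<exists>t\<le>d * (B + 1) + 1. \<exists>h'. exec K (While b c) h T t h' T \<and> I N h'"
    if "I j h" "j + d = N" for j d h
    using that
  proof (induction d arbitrary: j h)
    case 0
    then have "\<not> b (reads K h T)"
      using assms(2) by simp
    then show ?case
      using 0 exec_While_False[of b K h T c] by (intro exI[of _ 1] conjI exI[of _ h]) auto
  next
    case (Suc d)
    then obtain t1 h1 where 1: "t1 \<le> B" "exec K c h T t1 h1 T" "I (Suc j) h1"
      using body[of j] by (auto simp: hoare_def)
    have "Suc j + d = N"
      using Suc.prems by simp
    then obtain t2 h2 where 2: "t2 \<le> d * (B + 1) + 1" "exec K (While b c) h1 T t2 h2 T" "I N h2"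
      using Suc.IH[OF 1(3)] by blast
    have "b (reads K h T)"
      using assms(1)[of j h] Suc.prems by simp
    then show ?case
      using 1 2 exec_While_True[OF _ 1(2) 2(2)]
      by (intro exI[of _ "1 + t1 + t2"] conjI exI[of _ h2]) auto
  qed
  from this[of 0 _ N] show ?thesis
    by (auto simp: hoare_def)
qed

text \<open>The sum of \<open>n * (B + 2) + 1\<close> for the forward loop, \<open>2 * n + 1\<close>
  for the rewinding and 2 for the moves at the turning points.\<close>

definition for_time :: "nat \<Rightarrow> nat \<Rightarrow> nat" where
  "for_time n B = n * (B + 4) + 4"

text \<open>The cells \<open>n\<close> and \<open>-1\<close> stop the forward and the rewinding loop
  of \<open>For\<close>.\<close>

definition ruler :: "nat \<Rightarrow> (nat \<Rightarrow> int \<Rightarrow> nat) \<Rightarrow> nat \<Rightarrow> nat \<Rightarrow> bool" where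
  "ruler K T i n \<longleftrightarrow> i < K \<and> (\<forall>p. 0 \<le> p \<and> p < int n \<longrightarrow> T i p = 2) \<and> T i (int n) \<noteq> 2 \<and> T i (-1) \<noteq> 2"

text \<open>Resetting head \<open>i\<close> inside \<open>Q\<close> hides the loop counter from
  assertions about the other heads; outside the loop the head is at 0 and the update
  vanishes.\<close>

lemma hoare_For:
  assumes ruler: "ruler K T i n"
    and body: "\<And>j. j < n \<Longrightarrow> hoare K T (\<lambda>h. h i = int j \<and> Q j (h(i := 0))) c B
      (\<lambda>h. h i = int j \<and> Q (Suc j) (h(i := 0)))"
  shows "hoare K T (\<lambda>h. h i = 0 \<and> Q 0 h) (For i c) (for_time n B) (\<lambda>h. h i = 0 \<and> Q n h)"
proof -
  have upd: "(\<lambda>j. h j + (if j \<in> {i} then d else 0))(i := 0) = h(i := 0)" for h :: "nat \<Rightarrow> int" and d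
    by auto
  have upd': "h(i := 0) = h" if "h i = 0" for h :: "nat \<Rightarrow> int"
    using that by auto
  have r: "i < K" "\<And>p. 0 \<le> p \<Longrightarrow> p < int n \<Longrightarrow> T i p = 2" "T i (int n) \<noteq> 2" "T i (-1) \<noteq> 2"
    using ruler by (auto simp: ruler_def)
  have W1: "hoare K T (\<lambda>h. h i = int 0 \<and> Q 0 (h(i := 0)))
      (While (\<lambda>r. r i = 2) (c ;; Go {i} Go_Right)) (n * (B + 1 + 1) + 1)
      (\<lambda>h. h i = int n \<and> Q n (h(i := 0)))"
  proof (rule hoare_While)
    fix j assume "j < n"
    then show "hoare K T (\<lambda>h. h i = int j \<and> Q j (h(i := 0))) (c ;; Go {i} Go_Right) (B + 1)
        (\<lambda>h. h i = int (Suc j) \<and> Q (Suc j) (h(i := 0)))"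
      by (intro hoare_Seq[OF body] hoare_Go) (auto simp only: upd, auto)
  qed (use r in \<open>auto simp: reads_def\<close>)
  have G1: "hoare K T (\<lambda>h. h i = int n \<and> Q n (h(i := 0))) (Go {i} Go_Left) 1
      (\<lambda>h. h i = int n - 1 - int 0 \<and> Q n (h(i := 0)))"
    by (rule hoare_Go) (auto simp only: upd, auto)
  have W2: "hoare K T (\<lambda>h. h i = int n - 1 - int 0 \<and> Q n (h(i := 0)))
      (While (\<lambda>r. r i = 2) (Go {i} Go_Left)) (n * (1 + 1) + 1)
      (\<lambda>h. h i = int n - 1 - int n \<and> Q n (h(i := 0)))"
  proof (rule hoare_While)
    fix j
    show "hoare K T (\<lambda>h. h i = int n - 1 - int j \<and> Q n (h(i := 0))) (Go {i} Go_Left) 1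
        (\<lambda>h. h i = int n - 1 - int (Suc j) \<and> Q n (h(i := 0)))"
      by (rule hoare_Go) (auto simp only: upd, auto)
  qed (use r in \<open>auto simp: reads_def\<close>)
  have G2: "hoare K T (\<lambda>h. h i = int n - 1 - int n \<and> Q n (h(i := 0))) (Go {i} Go_Right) 1
      (\<lambda>h. h i = 0 \<and> Q n (h(i := 0)))"
    by (rule hoare_Go) (auto simp only: upd, auto)
  show ?thesis
    unfolding For_def
    by (rule hoare_conseq[OF hoare_Seq[OF W1 hoare_Seq[OF G1 hoare_Seq[OF W2 G2]]]])
      (auto simp: upd' for_time_def algebra_simps)
qed

section \<open>The verifier\<close>

text \<open>Tapes 0, 4, 5 and 6 hold the input: 0 scans the matrix and the two sets, 4 and 5 are the row
  and column rulers, and 6 counts jumps along the unary number of jumps. Tapes 1, 2 and 3 hold the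
  certificate: 1 and 2 are the row and column positions in the current block, 3 is the row
  position in the next block. Tapes 7 and 8 are marked at 0: 7 leaves the mark on failure, and 8
  tracks the difference in cardinality of consecutive sets.\<close>

definition copy_com :: com where
  "copy_com =
     Act (\<lambda>r i. (if i \<in> {7, 8} then 1 else r i, Stay)) ;;
     While (\<lambda>r. r 0 \<noteq> 0 \<or> r 1 \<noteq> 0)
       (Act (\<lambda>r i. (if i \<in> {2, 3} then r 1 else if i \<in> {4, 5, 6} then r 0 else r i, Go_Right))) ;;
     While (\<lambda>r. r 7 \<noteq> 1) (Go UNIV Go_Left)"

definition compare_com :: com where
  "compare_com = Mv (\<lambda>r i. if i \<in> {0, 2} then Go_Right
     else if i = 7 \<and> (r 0 = 2) \<noteq> (r 2 = 2) then Go_Left else Stay)"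

definition setup_com :: com where
  "setup_com =
     For 4 (Go {0, 3, 6} Go_Right) ;; Go {0, 6} Go_Right ;;
     While (\<lambda>r. r 0 = 2) (Go {0} Go_Right) ;; Go {0} Go_Right ;;
     For 4 (For 5 (Go {0} Go_Right)) ;; For 4 compare_com ;;
     For 4 (Go {0, 2} Go_Left) ;; For 4 (For 5 (Go {0} Go_Left))"

text \<open>Only departing tokens advance tape 6, so running off the unary number means more than
  \<open>k\<close> jumps. Departures and arrivals move tape 8 in opposite directions: after a block
  begun on the mark, it is back there iff both sets have the same size.\<close>

definition count_com :: com where
  "count_com = Mv (\<lambda>r i.
     if r 1 = 2 \<and> r 3 \<noteq> 2 then
       (if i = 8 \<or> i = 6 \<and> r 6 = 2 then Go_Right else if i = 7 \<and> r 6 \<noteq> 2 then Go_Left else Stay)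
     else if r 1 \<noteq> 2 \<and> r 3 = 2 \<and> i = 8 then Go_Left else Stay)"

definition edge_com :: com where
  "edge_com = Mv (\<lambda>r i. if i \<in> {0, 2} then Go_Right
     else if i = 7 \<and> r 0 = 2 \<and> r 1 = 2 \<and> r 2 = 2 then Go_Left else Stay)"

definition row_com :: com where
  "row_com = count_com ;; For 5 edge_com ;; For 5 (Go {2} Go_Left) ;; Go {1, 3} Go_Right"

text \<open>The head may stand just behind the unary number, where the loop test would fail at once;
  hence the first move to the left.\<close>

definition rewind_com :: com where
  "rewind_com = Go {6} Go_Left ;; While (\<lambda>r. r 6 = 2) (Go {6} Go_Left) ;; Go {6} Go_Right"

text \<open>The size test comes last. If it fails, tape 8 stays displaced, which is harmless because
  failure is permanent; the invariants constrain tape 8 only when all earlier blocks have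
  passed.\<close>

definition block_com :: com where
  "block_com =
     For 4 row_com ;; For 4 (Go {2} Go_Right) ;; For 4 (For 5 (Go {0} Go_Left)) ;;
     rewind_com ;; Mv (\<lambda>r i. if i = 7 \<and> r 8 \<noteq> 1 then Go_Left else Stay)"

definition final_com :: com where
  "final_com =
     For 4 (For 5 (Go {0} Go_Right)) ;; For 4 (Go {0} Go_Right) ;; For 4 compare_com"

text \<open>A nonblank cell under head 3 means that the next block begins within the certificate.
  For \<open>n = 0\<close> head 3 would never advance; the test on tape 4 rules out that infinite
  loop.\<close>

definition main_com :: com where
  "main_com = setup_com ;; While (\<lambda>r. r 3 \<noteq> 0 \<and> r 4 = 2) block_com ;; final_com"

lemma com_wf_verifier: "com_wf 3 (copy_com ;; main_com)"
  by (simp add: copy_com_def main_com_def setup_com_def block_com_def row_com_def rewind_com_def final_com_def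
      compare_com_def count_com_def edge_com_def For_def Go_def Mv_def)

section \<open>Invariants over head positions\<close>

definition heads :: "int \<Rightarrow> int \<Rightarrow> int \<Rightarrow> int \<Rightarrow> int \<Rightarrow> int \<Rightarrow> int \<Rightarrow> (nat \<Rightarrow> int) \<Rightarrow> bool" where
  "heads m a b nx r c p h \<longleftrightarrow> h 0 = m \<and> h 1 = a \<and> h 2 = b \<and> h 3 = nx \<and> h 4 = r \<and> h 5 = c \<and> h 6 = p"

lemma card_less_Suc:
  "card {v. v < Suc a \<and> P v} = card {v. v < a \<and> P v} + (if P a then 1 else 0)"
proof -
  have "{v. v < Suc a \<and> P v} = (if P a then insert a {v. v < a \<and> P v} else {v. v < a \<and> P v})"
    by (auto simp: less_Suc_eq)
  then show ?thesis
    by simp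
qed

text \<open>These assumptions hold for every pair of strings, see \<open>scan_input_tape\<close>, so
  the time bounds are not tied to encoded instances.\<close>

locale scan =
  fixes X U :: "int \<Rightarrow> nat" and n k len :: nat
  assumes X: "\<And>p. 0 \<le> p \<Longrightarrow> p < int n \<Longrightarrow> X p = 2" "X (int n) \<noteq> 2" "X (-1) \<noteq> 2"
      "\<And>p. int n < p \<Longrightarrow> p \<le> int n + int k \<Longrightarrow> X p = 2" "X (int n + int k + 1) \<noteq> 2"
    and U: "\<And>p. int len \<le> p \<Longrightarrow> U p = 0"
begin

definition T :: "nat \<Rightarrow> int \<Rightarrow> nat" where
  "T i = (if i \<in> {0, 4, 5, 6} then X else if i \<in> {1, 2, 3} then U
          else if i \<in> {7, 8} then (\<lambda>p. if p = 0 then 1 else 0) else (\<lambda>_. 0))"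

lemma reads_T:
  "reads 9 h T 0 = X (h 0)" "reads 9 h T 1 = U (h 1)" "reads 9 h T 2 = U (h 2)"
  "reads 9 h T 3 = U (h 3)" "reads 9 h T 4 = X (h 4)" "reads 9 h T 5 = X (h 5)"
  "reads 9 h T 6 = X (h 6)" "reads 9 h T 7 = (if h 7 = 0 then 1 else 0)"
  "reads 9 h T 8 = (if h 8 = 0 then 1 else 0)" "reads 9 h T (Suc 0) = U (h (Suc 0))"
  by (auto simp: reads_def T_def)

lemma rulers: "ruler 9 T 4 n" "ruler 9 T 5 n"
  using X by (auto simp: ruler_def T_def)

text \<open>The matrix is preceded by \<open>n\<close> ones, a separator, \<open>k\<close> ones and
  a separator.\<close>

definition m0 :: int where
  "m0 = int n + int k + 2"

definition edge :: "nat \<Rightarrow> nat \<Rightarrow> bool" where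
  "edge a b \<longleftrightarrow> X (m0 + int a * int n + int b) = 2"

definition S :: "nat \<Rightarrow> nat set" where
  "S j = {v. v < n \<and> U (int j * int n + int v) = 2}"

definition moved :: "nat \<Rightarrow> nat \<Rightarrow> nat \<Rightarrow> nat" where
  "moved i j a = card {v. v < a \<and> v \<in> S i \<and> v \<notin> S j}"

definition conflict :: "nat \<Rightarrow> nat \<Rightarrow> nat \<Rightarrow> bool" where
  "conflict j a b \<longleftrightarrow> edge a b \<and> a \<in> S j \<and> b \<in> S j"

text \<open>Independence is required of \<open>S j\<close> only: the next block tests
  \<open>S (Suc j)\<close>, and the last set is compared with the target, which is independent in
  any instance.\<close>

definition good :: "nat \<Rightarrow> bool" where
  "good j \<longleftrightarrow> card (S j - S (Suc j)) \<le> k \<and> card (S j - S (Suc j)) = card (S (Suc j) - S j) \<and>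
     (\<forall>a<n. \<forall>b<n. \<not> conflict j a b)"

lemma moved_n: "moved i j n = card (S i - S j)"
  unfolding moved_def by (rule arg_cong[of _ _ card]) (auto simp: S_def)

lemma moved_Suc: "moved i j (Suc a) = moved i j a + (if a \<in> S i \<and> a \<notin> S j then 1 else 0)"
  unfolding moved_def by (rule card_less_Suc)

text \<open>Head 6 stops behind the unary number, so its offset is capped at \<open>k\<close>, and
  it reads 2 exactly while another departure is allowed.\<close>

lemma P_reads: "X (int n + 1 + int (min k c)) = 2 \<longleftrightarrow> c < k"
proof (cases "c < k")
  case True
  then show ?thesis
    using X(4)[of "int n + 1 + int c"] by simp
next
  case False
  then show ?thesis
    using X(5) by (simp add: min_def algebra_simps)
qed

text \<open>Head 7 only moves left, so being at 0 means that no check has failed. \<open>ok\<close>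
  is the outcome of the earlier blocks; without it head 8 may have begun the block off its mark,
  hence the implication.\<close>

definition row_inv :: "nat \<Rightarrow> bool \<Rightarrow> nat \<Rightarrow> (nat \<Rightarrow> int) \<Rightarrow> bool" where
  "row_inv j ok a h \<longleftrightarrow>
     heads (m0 + int a * int n) (int j * int n + int a) (int j * int n) (int (Suc j) * int n + int a)
       0 0 (int n + 1 + int (min k (moved j (Suc j) a))) h \<and>
     h 7 \<le> 0 \<and> (ok \<longrightarrow> h 8 = int (moved j (Suc j) a) - int (moved (Suc j) j a)) \<and>
     (h 7 = 0 \<longleftrightarrow> ok \<and> moved j (Suc j) a \<le> k \<and> (\<forall>a'<a. \<forall>b<n. \<not> conflict j a' b))"

text \<open>The counts already include vertex \<open>a\<close>, because \<open>count_com\<close>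
  precedes the scan of the columns.\<close>

definition col_inv :: "nat \<Rightarrow> bool \<Rightarrow> nat \<Rightarrow> nat \<Rightarrow> (nat \<Rightarrow> int) \<Rightarrow> bool" where
  "col_inv j ok a b h \<longleftrightarrow>
     heads (m0 + int a * int n + int b) (int j * int n + int a) (int j * int n + int b)
       (int (Suc j) * int n + int a) (int a) 0 (int n + 1 + int (min k (moved j (Suc j) (Suc a)))) h \<and>
     h 7 \<le> 0 \<and> (ok \<longrightarrow> h 8 = int (moved j (Suc j) (Suc a)) - int (moved (Suc j) j (Suc a))) \<and>
     (h 7 = 0 \<longleftrightarrow> ok \<and> moved j (Suc j) (Suc a) \<le> k \<and>
        (\<forall>a'<a. \<forall>b<n. \<not> conflict j a' b) \<and> (\<forall>b'<b. \<not> conflict j a b'))"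

lemma hoare_count:
  assumes "a < n"
  shows "hoare 9 T (\<lambda>h. h 4 = int a \<and> row_inv j ok a (h(4 := 0))) count_com 1
    (\<lambda>h. h 5 = 0 \<and> col_inv j ok a 0 h)"
  unfolding count_com_def
proof (rule hoare_Mv)
  fix h assume h: "h 4 = int a \<and> row_inv j ok a (h(4 := 0))"
  have U: "U (int j * int n + int a) = 2 \<longleftrightarrow> a \<in> S j"
      "U (int (Suc j) * int n + int a) = 2 \<longleftrightarrow> a \<in> S (Suc j)"
    using assms by (auto simp: S_def)
  have P: "X (h 6) = 2 \<longleftrightarrow> moved j (Suc j) a < k"
    using h P_reads[of "moved j (Suc j) a"] by (simp add: row_inv_def heads_def)
  have UA: "U (h 1) = 2 \<longleftrightarrow> a \<in> S j" "U (h 3) = 2 \<longleftrightarrow> a \<in> S (Suc j)"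
    using h U by (simp_all add: row_inv_def heads_def del: of_nat_Suc)
  show "(\<lambda>i. h i + offset (if reads 9 h T 1 = 2 \<and> reads 9 h T 3 \<noteq> 2 then
       (if i = 8 \<or> i = 6 \<and> reads 9 h T 6 = 2 then Go_Right
        else if i = 7 \<and> reads 9 h T 6 \<noteq> 2 then Go_Left else Stay)
     else if reads 9 h T 1 \<noteq> 2 \<and> reads 9 h T 3 = 2 \<and> i = 8 then Go_Left else Stay)) 5 = 0 \<and>
     col_inv j ok a 0 (\<lambda>i. h i + offset (if reads 9 h T 1 = 2 \<and> reads 9 h T 3 \<noteq> 2 then
       (if i = 8 \<or> i = 6 \<and> reads 9 h T 6 = 2 then Go_Right
        else if i = 7 \<and> reads 9 h T 6 \<noteq> 2 then Go_Left else Stay)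
     else if reads 9 h T 1 \<noteq> 2 \<and> reads 9 h T 3 = 2 \<and> i = 8 then Go_Left else Stay))"
    using h unfolding reads_T UA P
    by (auto simp: row_inv_def col_inv_def heads_def moved_Suc)
qed

lemma hoare_edge:
  assumes "a < n" "b < n"
  shows "hoare 9 T (\<lambda>h. h 5 = int b \<and> col_inv j ok a b (h(5 := 0))) edge_com 1
    (\<lambda>h. h 5 = int b \<and> col_inv j ok a (Suc b) (h(5 := 0)))"
  unfolding edge_com_def
proof (rule hoare_Mv)
  fix h assume h: "h 5 = int b \<and> col_inv j ok a b (h(5 := 0))"
  have R: "X (h 0) = 2 \<longleftrightarrow> edge a b" "U (h 1) = 2 \<longleftrightarrow> a \<in> S j" "U (h 2) = 2 \<longleftrightarrow> b \<in> S j"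
    using h assms by (auto simp: col_inv_def heads_def edge_def S_def)
  show "(\<lambda>i. h i + offset (if i \<in> {0, 2} then Go_Right
     else if i = 7 \<and> reads 9 h T 0 = 2 \<and> reads 9 h T 1 = 2 \<and> reads 9 h T 2 = 2 then Go_Left else Stay)) 5 = int b \<and>
     col_inv j ok a (Suc b) ((\<lambda>i. h i + offset (if i \<in> {0, 2} then Go_Right
     else if i = 7 \<and> reads 9 h T 0 = 2 \<and> reads 9 h T 1 = 2 \<and> reads 9 h T 2 = 2 then Go_Left else Stay))(5 := 0))"
    using h unfolding reads_T R
    by (auto simp: col_inv_def heads_def conflict_def less_Suc_eq)
qed

definition col_back :: "nat \<Rightarrow> bool \<Rightarrow> nat \<Rightarrow> nat \<Rightarrow> (nat \<Rightarrow> int) \<Rightarrow> bool" where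
  "col_back j ok a b h \<longleftrightarrow> col_inv j ok a n (h(2 := int j * int n + int n)) \<and>
     h 2 = int j * int n + int n - int b"

lemma hoare_row:
  assumes "a < n"
  shows "hoare 9 T (\<lambda>h. h 4 = int a \<and> row_inv j ok a (h(4 := 0))) row_com
    (1 + (for_time n 1 + (for_time n 1 + 1)))
    (\<lambda>h. h 4 = int a \<and> row_inv j ok (Suc a) (h(4 := 0)))"
  unfolding row_com_def
proof (intro hoare_Seq)
  show "hoare 9 T (\<lambda>h. h 4 = int a \<and> row_inv j ok a (h(4 := 0))) count_com 1
    (\<lambda>h. h 5 = 0 \<and> col_inv j ok a 0 h)"
    by (rule hoare_count[OF assms])
  show "hoare 9 T (\<lambda>h. h 5 = 0 \<and> col_inv j ok a 0 h) (For 5 edge_com) (for_time n 1)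
    (\<lambda>h. h 5 = 0 \<and> col_inv j ok a n h)"
    by (rule hoare_For[OF rulers(2) hoare_edge[OF assms]])
  have "hoare 9 T (\<lambda>h. h 5 = 0 \<and> col_back j ok a 0 h) (For 5 (Go {2} Go_Left)) (for_time n 1)
    (\<lambda>h. h 5 = 0 \<and> col_back j ok a n h)"
    by (intro hoare_For[OF rulers(2)] hoare_Go) (auto simp: col_back_def col_inv_def heads_def)
  then show "hoare 9 T (\<lambda>h. h 5 = 0 \<and> col_inv j ok a n h) (For 5 (Go {2} Go_Left)) (for_time n 1)
    (\<lambda>h. h 5 = 0 \<and> col_back j ok a n h)"
    by (rule hoare_conseq) (auto simp: col_back_def col_inv_def heads_def)
  show "hoare 9 T (\<lambda>h. h 5 = 0 \<and> col_back j ok a n h) (Go {1, 3} Go_Right) 1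
    (\<lambda>h. h 4 = int a \<and> row_inv j ok (Suc a) (h(4 := 0)))"
    by (rule hoare_Go)
      (auto simp: col_back_def col_inv_def row_inv_def heads_def less_Suc_eq algebra_simps)
qed

text \<open>\<open>R\<close> carries what is known of heads 7 and 8 through movements that leave
  them alone; the rulers 4 and 5 rest at 0 between phases.\<close>

definition st :: "(int \<Rightarrow> int \<Rightarrow> bool) \<Rightarrow> int \<Rightarrow> int \<Rightarrow> int \<Rightarrow> int \<Rightarrow> int \<Rightarrow> (nat \<Rightarrow> int) \<Rightarrow> bool" where
  "st R m a b nx p h \<longleftrightarrow> heads m a b nx 0 0 p h \<and> R (h 7) (h 8)"

text \<open>No ruler of length \<open>n * n\<close> is on the tape; two nested ones of length
  \<open>n\<close> replace it.\<close>

lemma hoare_shift: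
  "hoare 9 T (st R m a b nx p) (For 4 (For 5 (Go {0} d))) (for_time n (for_time n 1))
    (st R (m + offset d * int n * int n) a b nx p)"
proof -
  define I where "I i h \<longleftrightarrow> h 5 = 0 \<and> st R (m + offset d * int i * int n) a b nx p h"
    for i :: nat and h :: "nat \<Rightarrow> int"
  define I' where "I' i l h \<longleftrightarrow> h 4 = int i \<and>
      st R (m + offset d * int i * int n + offset d * int l) a b nx p (h(4 := 0))"
    for i l :: nat and h :: "nat \<Rightarrow> int"
  have "hoare 9 T (\<lambda>h. h 4 = 0 \<and> I 0 h) (For 4 (For 5 (Go {0} d))) (for_time n (for_time n 1))
      (\<lambda>h. h 4 = 0 \<and> I n h)"
  proof (rule hoare_For[OF rulers(1)])
    fix i
    have "hoare 9 T (\<lambda>h. h 5 = 0 \<and> I' i 0 h) (For 5 (Go {0} d)) (for_time n 1)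
        (\<lambda>h. h 5 = 0 \<and> I' i n h)"
      by (intro hoare_For[OF rulers(2)] hoare_Go) (auto simp: I'_def st_def heads_def algebra_simps)
    then show "hoare 9 T (\<lambda>h. h 4 = int i \<and> I i (h(4 := 0))) (For 5 (Go {0} d)) (for_time n 1)
        (\<lambda>h. h 4 = int i \<and> I (Suc i) (h(4 := 0)))"
      by (rule hoare_conseq) (auto simp: I_def I'_def st_def heads_def algebra_simps)
  qed
  then show ?thesis
    by (rule hoare_conseq) (auto simp: I_def st_def heads_def algebra_simps)
qed

lemma hoare_For_Go:
  assumes "A \<subseteq> {0, 1, 2, 3, 6}"
  shows "hoare 9 T (st R m a b nx p) (For 4 (Go A d)) (for_time n 1)
    (st R (if 0 \<in> A then m + offset d * int n else m) (if 1 \<in> A then a + offset d * int n else a)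
      (if 2 \<in> A then b + offset d * int n else b) (if 3 \<in> A then nx + offset d * int n else nx)
      (if 6 \<in> A then p + offset d * int n else p))"
proof -
  define I where "I i h \<longleftrightarrow> st R (if 0 \<in> A then m + offset d * int i else m)
      (if 1 \<in> A then a + offset d * int i else a) (if 2 \<in> A then b + offset d * int i else b)
      (if 3 \<in> A then nx + offset d * int i else nx) (if 6 \<in> A then p + offset d * int i else p) h"
    for i :: nat and h :: "nat \<Rightarrow> int"
  have A: "4 \<notin> A" "5 \<notin> A" "7 \<notin> A" "8 \<notin> A"
    using assms by auto
  have "hoare 9 T (\<lambda>h. h 4 = 0 \<and> I 0 h) (For 4 (Go A d)) (for_time n 1) (\<lambda>h. h 4 = 0 \<and> I n h)"
    by (intro hoare_For[OF rulers(1)] hoare_Go) (use A in \<open>auto simp: I_def st_def heads_def algebra_simps\<close>)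
  then show ?thesis
    by (rule hoare_conseq) (auto simp: I_def st_def heads_def)
qed

lemma hoare_rewind:
  assumes "c \<le> k"
  shows "hoare 9 T (st R m a b nx (int n + 1 + int c))
    rewind_com (1 + ((k * 2 + 1) + 1)) (st R m a b nx (int n + 1))"
proof -
  define I where "I i = st R m a b nx (int n + int c - int i)" for i :: nat
  have 1: "hoare 9 T (st R m a b nx (int n + 1 + int c)) (Go {6} Go_Left) 1 (I 0)"
    by (rule hoare_Go) (auto simp: I_def st_def heads_def)
  have 2: "hoare 9 T (I 0) (While (\<lambda>r. r 6 = 2) (Go {6} Go_Left)) (c * (1 + 1) + 1) (I c)"
    by (intro hoare_While hoare_Go) (use assms X in \<open>auto simp: I_def st_def heads_def reads_T\<close>)
  have 3: "hoare 9 T (I c) (Go {6} Go_Right) 1 (st R m a b nx (int n + 1))"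
    by (rule hoare_Go) (auto simp: I_def st_def heads_def)
  show ?thesis
    unfolding rewind_com_def
    by (rule hoare_conseq[OF hoare_Seq[OF 1 hoare_Seq[OF 2 3]]]) (use assms in auto)
qed

text \<open>\<open>bal\<close> is separate from \<open>ok\<close>: during setup head 8 is on its
  mark whatever the comparison says, but after later blocks only if all checks succeeded.\<close>

definition verdict :: "bool \<Rightarrow> bool \<Rightarrow> int \<Rightarrow> int \<Rightarrow> bool" where
  "verdict ok bal f d \<longleftrightarrow> f \<le> 0 \<and> (f = 0 \<longleftrightarrow> ok) \<and> (bal \<longrightarrow> d = 0)"

lemma hoare_compare:
  "hoare 9 T (st (verdict ok bal) m a b nx p) (For 4 compare_com) (for_time n 1)
    (st (verdict (ok \<and> (\<forall>v<n. X (m + int v) = 2 \<longleftrightarrow> U (b + int v) = 2)) bal)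
      (m + int n) a (b + int n) nx p)"
proof -
  define I where "I i = st (verdict (ok \<and> (\<forall>v<i. X (m + int v) = 2 \<longleftrightarrow> U (b + int v) = 2)) bal)
      (m + int i) a (b + int i) nx p" for i :: nat
  have "hoare 9 T (\<lambda>h. h 4 = 0 \<and> I 0 h) (For 4 compare_com) (for_time n 1) (\<lambda>h. h 4 = 0 \<and> I n h)"
    unfolding compare_com_def
    by (intro hoare_For[OF rulers(1)] hoare_Mv)
      (auto simp: I_def st_def heads_def verdict_def reads_T less_Suc_eq)
  then show ?thesis
    by (rule hoare_conseq) (auto simp: I_def st_def heads_def)
qed

section \<open>The phases of the verifier and its main loop\<close>

definition source_ok :: bool where
  "source_ok \<longleftrightarrow> (\<forall>v<n. X (m0 + int n * int n + int v) = 2 \<longleftrightarrow> v \<in> S 0)"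

definition target_ok :: "nat \<Rightarrow> bool" where
  "target_ok j \<longleftrightarrow> (\<forall>v<n. X (m0 + int n * int n + int n + int v) = 2 \<longleftrightarrow> v \<in> S j)"

definition ok :: "nat \<Rightarrow> bool" where
  "ok j \<longleftrightarrow> source_ok \<and> (\<forall>i<j. good i)"

definition block_inv :: "nat \<Rightarrow> (nat \<Rightarrow> int) \<Rightarrow> bool" where
  "block_inv j = st (verdict (ok j) (ok j)) m0 (int j * int n) (int j * int n)
     (int (Suc j) * int n) (int n + 1)"

definition block_time :: nat where
  "block_time = for_time n (1 + (for_time n 1 + (for_time n 1 + 1))) +
     (for_time n 1 + (for_time n (for_time n 1) + (1 + ((k * 2 + 1) + 1)) + 1))"

lemma hoare_block: "hoare 9 T (block_inv j) block_com block_time (block_inv (Suc j))"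
proof -
  define c where "c = moved j (Suc j) n"
  define R where "R f d \<longleftrightarrow> f \<le> 0 \<and> (ok j \<longrightarrow> d = int c - int (moved (Suc j) j n)) \<and>
     (f = 0 \<longleftrightarrow> ok j \<and> c \<le> k \<and> (\<forall>a'<n. \<forall>b<n. \<not> conflict j a' b))" for f d :: int
  let ?a = "int (Suc j) * int n" and ?nx = "int (Suc (Suc j)) * int n" and ?p = "int n + 1 + int (min k c)"
  have "hoare 9 T (\<lambda>h. h 4 = 0 \<and> row_inv j (ok j) 0 h) (For 4 row_com)
      (for_time n (1 + (for_time n 1 + (for_time n 1 + 1)))) (\<lambda>h. h 4 = 0 \<and> row_inv j (ok j) n h)"
    by (rule hoare_For[OF rulers(1) hoare_row])
  then have 1: "hoare 9 T (block_inv j) (For 4 row_com)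
      (for_time n (1 + (for_time n 1 + (for_time n 1 + 1))))
      (st R (m0 + int n * int n) ?a (int j * int n) ?nx ?p)"
    by (rule hoare_conseq)
      (auto simp: block_inv_def row_inv_def st_def heads_def verdict_def R_def c_def moved_def algebra_simps)
  have 2: "hoare 9 T (st R (m0 + int n * int n) ?a (int j * int n) ?nx ?p) (For 4 (Go {2} Go_Right))
      (for_time n 1) (st R (m0 + int n * int n) ?a ?a ?nx ?p)"
    by (rule hoare_conseq[OF hoare_For_Go]) (auto simp: algebra_simps)
  have 3: "hoare 9 T (st R (m0 + int n * int n) ?a ?a ?nx ?p) (For 4 (For 5 (Go {0} Go_Left)))
      (for_time n (for_time n 1)) (st R m0 ?a ?a ?nx ?p)"
    by (rule hoare_conseq[OF hoare_shift]) (auto simp: algebra_simps)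
  have 4: "hoare 9 T (st R m0 ?a ?a ?nx ?p)
      rewind_com (1 + ((k * 2 + 1) + 1)) (st R m0 ?a ?a ?nx (int n + 1))"
    by (rule hoare_rewind) simp
  \<comment> \<open>If all earlier blocks passed, \<open>d\<close> is departures minus arrivals, so
    \<open>d = 0\<close> supplies the remaining clause of \<open>good j\<close>.\<close>
  have R: "verdict (ok (Suc j)) (ok (Suc j)) (if d = 0 then f else f - 1) d" if "R f d" for f d
    using that by (auto simp: R_def verdict_def ok_def good_def c_def moved_n less_Suc_eq)
  have 5: "hoare 9 T (st R m0 ?a ?a ?nx (int n + 1))
      (Mv (\<lambda>r i. if i = 7 \<and> r 8 \<noteq> 1 then Go_Left else Stay)) 1 (block_inv (Suc j))"
  proof (rule hoare_Mv)
    fix h assume h: "st R m0 ?a ?a ?nx (int n + 1) h"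
    then have "verdict (ok (Suc j)) (ok (Suc j)) (if h 8 = 0 then h 7 else h 7 - 1) (h 8)"
      using R by (simp add: st_def)
    then show "block_inv (Suc j) (\<lambda>i. h i + offset (if i = 7 \<and> reads 9 h T 8 \<noteq> 1 then Go_Left else Stay))"
      using h by (auto simp: block_inv_def st_def heads_def reads_T)
  qed
  show ?thesis
    unfolding block_com_def block_time_def
    by (rule hoare_conseq[OF hoare_Seq[OF 1 hoare_Seq[OF 2 hoare_Seq[OF 3 hoare_Seq[OF 4 5]]]]]) auto
qed

definition setup_time :: nat where
  "setup_time = for_time n 1 + (1 + ((k * 2 + 1) + (1 + (for_time n (for_time n 1) +
     (for_time n 1 + (for_time n 1 + for_time n (for_time n 1)))))))"

lemma hoare_setup: "hoare 9 T (\<lambda>h. h = (\<lambda>_. 0)) setup_com setup_time (block_inv 0)"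
proof -
  let ?R = "verdict True True" and ?p = "int n + 1" and ?nx = "int n"
  let ?R' = "verdict (ok 0) True"
  have 1: "hoare 9 T (\<lambda>h. h = (\<lambda>_. 0)) (For 4 (Go {0, 3, 6} Go_Right)) (for_time n 1)
      (st ?R (int n) 0 0 ?nx (int n))"
    by (rule hoare_conseq[OF hoare_For_Go[where R = ?R and m = 0 and a = 0 and b = 0 and nx = 0 and p = 0]])
      (auto simp: st_def heads_def verdict_def)
  have 2: "hoare 9 T (st ?R (int n) 0 0 ?nx (int n)) (Go {0, 6} Go_Right) 1 (st ?R (int n + 1) 0 0 ?nx ?p)"
    by (rule hoare_Go) (auto simp: st_def heads_def)
  define I where "I i = st ?R (int n + 1 + int i) 0 0 ?nx ?p" for i :: nat
  have 3: "hoare 9 T (I 0) (While (\<lambda>r. r 0 = 2) (Go {0} Go_Right)) (k * (1 + 1) + 1) (I k)"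
    by (intro hoare_While hoare_Go)
      (use X in \<open>auto simp: I_def st_def heads_def reads_T algebra_simps\<close>)
  have 3: "hoare 9 T (st ?R (int n + 1) 0 0 ?nx ?p) (While (\<lambda>r. r 0 = 2) (Go {0} Go_Right))
      (k * 2 + 1) (st ?R (int n + 1 + int k) 0 0 ?nx ?p)"
    by (rule hoare_conseq[OF 3]) (auto simp: I_def)
  have 4: "hoare 9 T (st ?R (int n + 1 + int k) 0 0 ?nx ?p) (Go {0} Go_Right) 1 (st ?R m0 0 0 ?nx ?p)"
    by (rule hoare_Go) (auto simp: st_def heads_def m0_def)
  have 5: "hoare 9 T (st ?R m0 0 0 ?nx ?p) (For 4 (For 5 (Go {0} Go_Right))) (for_time n (for_time n 1))
      (st ?R (m0 + int n * int n) 0 0 ?nx ?p)"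
    by (rule hoare_conseq[OF hoare_shift]) auto
  have 6: "hoare 9 T (st ?R (m0 + int n * int n) 0 0 ?nx ?p) (For 4 compare_com) (for_time n 1)
      (st ?R' (m0 + int n * int n + int n) 0 (int n) ?nx ?p)"
    by (rule hoare_conseq[OF hoare_compare]) (auto simp: ok_def source_ok_def S_def)
  have 7: "hoare 9 T (st ?R' (m0 + int n * int n + int n) 0 (int n) ?nx ?p) (For 4 (Go {0, 2} Go_Left))
      (for_time n 1) (st ?R' (m0 + int n * int n) 0 0 ?nx ?p)"
    by (rule hoare_conseq[OF hoare_For_Go]) auto
  have 8: "hoare 9 T (st ?R' (m0 + int n * int n) 0 0 ?nx ?p) (For 4 (For 5 (Go {0} Go_Left)))
      (for_time n (for_time n 1)) (block_inv 0)"
    by (rule hoare_conseq[OF hoare_shift[where R = ?R']]) (auto simp: block_inv_def st_def verdict_def)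
  show ?thesis
    unfolding setup_com_def setup_time_def
    by (intro hoare_Seq) (rule 1 2 3 4 5 6 7 8)+
qed

text \<open>The number of blocks after the first one; the last of them may be cut short.\<close>

definition blocks :: nat where
  "blocks = (LEAST j. U (int (Suc j) * int n) = 0 \<or> n = 0)"

text \<open>For \<open>n > 0\<close> every block has at least one cell, so \<open>Suc len\<close>
  blocks reach past the end of the certificate.\<close>

lemma blocks_end: "U (int (Suc blocks) * int n) = 0 \<or> n = 0" "blocks \<le> len"
proof -
  have *: "U (int (Suc len) * int n) = 0 \<or> n = 0"
  proof (cases "n = 0")
    case False
    then have "len * 1 \<le> Suc len * n"
      by (intro mult_mono) auto
    then have "int len \<le> int (Suc len * n)"
      by linarith
    then have "int len \<le> int (Suc len) * int n"
      by (simp only: of_nat_mult)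
    then show ?thesis
      using U by blast
  qed simp
  show "U (int (Suc blocks) * int n) = 0 \<or> n = 0"
    unfolding blocks_def by (rule LeastI[of "\<lambda>j. U (int (Suc j) * int n) = 0 \<or> n = 0", OF *])
  show "blocks \<le> len"
    unfolding blocks_def by (rule Least_le) (rule *)
qed

lemma before_blocks:
  assumes "j < blocks"
  shows "U (int (Suc j) * int n) \<noteq> 0 \<and> 0 < n"
  using not_less_Least[OF assms[unfolded blocks_def]] by auto

text \<open>\<open>blocks\<close> is the least index at which the loop test fails, so the loop runs
  exactly that often.\<close>

lemma hoare_blocks:
  "hoare 9 T (block_inv 0) (While (\<lambda>r. r 3 \<noteq> 0 \<and> r 4 = 2) block_com)
    (len * (block_time + 1) + 1) (block_inv blocks)"
proof (rule hoare_conseq[OF hoare_While])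
  fix j h assume "j < blocks" "block_inv j h"
  then show "reads 9 h T 3 \<noteq> 0 \<and> reads 9 h T 4 = 2"
    using before_blocks[of j] X(1)[of 0]
    by (simp add: block_inv_def st_def heads_def reads_T del: of_nat_Suc)
next
  fix h assume "block_inv blocks h"
  then show "\<not> (reads 9 h T 3 \<noteq> 0 \<and> reads 9 h T 4 = 2)"
    using blocks_end(1) X(2) by (auto simp add: block_inv_def st_def heads_def reads_T simp del: of_nat_Suc)
next
  show "blocks * (block_time + 1) + 1 \<le> len * (block_time + 1) + 1"
    by (intro add_mono mult_mono blocks_end(2)) auto
qed (rule hoare_block | assumption)+

definition accepted :: bool where
  "accepted \<longleftrightarrow> source_ok \<and> (\<forall>i<blocks. good i) \<and> target_ok blocks"

definition final_time :: nat where
  "final_time = for_time n (for_time n 1) + (for_time n 1 + for_time n 1)"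

lemma hoare_final:
  "hoare 9 T (block_inv blocks) final_com final_time (\<lambda>h. h 7 = 0 \<longleftrightarrow> accepted)"
proof -
  let ?R = "verdict (ok blocks) (ok blocks)" and ?a = "int blocks * int n"
  let ?nx = "int (Suc blocks) * int n" and ?p = "int n + 1"
  have 1: "hoare 9 T (block_inv blocks) (For 4 (For 5 (Go {0} Go_Right))) (for_time n (for_time n 1))
      (st ?R (m0 + int n * int n) ?a ?a ?nx ?p)"
    unfolding block_inv_def by (rule hoare_conseq[OF hoare_shift]) auto
  have 2: "hoare 9 T (st ?R (m0 + int n * int n) ?a ?a ?nx ?p) (For 4 (Go {0} Go_Right)) (for_time n 1)
      (st ?R (m0 + int n * int n + int n) ?a ?a ?nx ?p)"
    by (rule hoare_conseq[OF hoare_For_Go]) auto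
  have 3: "hoare 9 T (st ?R (m0 + int n * int n + int n) ?a ?a ?nx ?p) (For 4 compare_com) (for_time n 1)
      (\<lambda>h. h 7 = 0 \<longleftrightarrow> accepted)"
    by (rule hoare_conseq[OF hoare_compare[where ok = "ok blocks" and bal = "ok blocks"]])
      (auto simp: st_def verdict_def accepted_def ok_def target_ok_def S_def)
  show ?thesis
    unfolding final_com_def final_time_def by (rule hoare_Seq[OF 1 hoare_Seq[OF 2 3]])
qed

lemma hoare_main:
  "hoare 9 T (\<lambda>h. h = (\<lambda>_. 0)) main_com
    (setup_time + ((len * (block_time + 1) + 1) + final_time)) (\<lambda>h. h 7 = 0 \<longleftrightarrow> accepted)"
  unfolding main_com_def by (rule hoare_Seq[OF hoare_setup hoare_Seq[OF hoare_blocks hoare_final]])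

end

section \<open>Copying the tapes and the total running time\<close>

lemma exec_ActI:
  assumes "\<And>i. h' i = h i + offset (snd (f (reads K h T) i))"
    and "\<And>i. T' i = (if i < K then (T i)(h i := fst (f (reads K h T) i)) else T i)"
  shows "exec K (Act f) h T 1 h' T'"
proof -
  have "h' = (\<lambda>i. h i + offset (snd (f (reads K h T) i)))"
    "T' = (\<lambda>i. if i < K then (T i)(h i := fst (f (reads K h T) i)) else T i)"
    using assms by auto
  then show ?thesis
    using exec_Act by simp
qed

lemma input_tape_nth:
  "snd (input_tape x) p = (if 0 \<le> p \<and> p < int (length x) then if x ! nat p then 2 else 1 else 0)"
  by (simp add: input_tape_def)

lemma input_tape_eq_0: "snd (input_tape x) p = 0 \<longleftrightarrow> p < 0 \<or> int (length x) \<le> p"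
  by (auto simp: input_tape_nth)

context scan
begin

text \<open>The only phase that changes tapes, so it is run in \<open>exec\<close> directly;
  \<open>C t\<close> is the tape contents after \<open>t\<close> copied cells. All heads move in
  lockstep, so the mark on tape 7 suffices to bring them back together.\<close>

lemma exec_copy:
  assumes x: "X = snd (input_tape x)" and u: "U = snd (input_tape u)"
  shows "\<exists>t \<le> 4 * (length x + length u) + 3.
    exec 9 copy_com (\<lambda>_. 0) (init_tapes x u) t (\<lambda>_. 0) T"
proof -
  define m where "m = max (length x) (length u)"
  define C where "C t i = (if i \<in> {2, 3} then (\<lambda>p. if p < int t then U p else 0)
      else if i \<in> {4, 5, 6} then (\<lambda>p. if p < int t then X p else 0) else T i)"
    for t and i :: nat
  let ?mark = "Act (\<lambda>r i. (if i \<in> {7, 8} then 1 else r i, Stay))"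
  let ?body = "Act (\<lambda>r i. (if i \<in> {2, 3} then r 1 else if i \<in> {4, 5, 6} then r 0 else r i, Go_Right))"
  let ?loop = "While (\<lambda>r. r 0 \<noteq> 0 \<or> r 1 \<noteq> 0) ?body"
  let ?back = "While (\<lambda>r. r 7 \<noteq> 1) (Go UNIV Go_Left)"
  have XU: "p < 0 \<Longrightarrow> X p = 0" "p < 0 \<Longrightarrow> U p = 0" "int m \<le> p \<Longrightarrow> X p = 0" "int m \<le> p \<Longrightarrow> U p = 0" for p
    by (auto simp: x u input_tape_eq_0 m_def)
  have 1: "exec 9 ?mark (\<lambda>_. 0) (init_tapes x u) 1 (\<lambda>_. 0) (C 0)"
  proof (rule exec_ActI)
    fix i
    have init: "init_tapes x u i = (if i = 0 then X else if i = 1 then U else (\<lambda>_. 0))" for i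
      by (auto simp: init_tapes_def x u input_tape_nth)
    have C0: "C 0 i = (if i = 0 then X else if i = 1 then U else
        if i \<in> {7, 8} then (\<lambda>_. 0)(0 := 1) else (\<lambda>_. 0))"
      using XU(1,2) by (auto simp: C_def T_def)
    show "C 0 i = (if i < 9 then (init_tapes x u i)(0 := fst (if i \<in> {7, 8} then 1
        else reads 9 (\<lambda>_. 0) (init_tapes x u) i, Stay)) else init_tapes x u i)"
      unfolding C0 by (auto simp: reads_def init)
  qed simp
  have 2: "exec 9 ?loop (\<lambda>_. int t) (C t) (2 * d + 1) (\<lambda>_. int m) (C m)" if "t + d = m" for t d
    using that
  proof (induction d arbitrary: t)
    case 0
    have "\<not> (reads 9 (\<lambda>_. int m) (C m) 0 \<noteq> 0 \<or> reads 9 (\<lambda>_. int m) (C m) 1 \<noteq> 0)"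
      using XU(3,4)[of "int m"] by (simp add: reads_def C_def T_def)
    then have "exec 9 ?loop (\<lambda>_. int m) (C m) 1 (\<lambda>_. int m) (C m)"
      by (rule exec_While_False)
    then show ?case
      using 0 by simp
  next
    case (Suc d)
    have "\<not> (X (int t) = 0 \<and> U (int t) = 0)"
      using Suc.prems by (auto simp: x u input_tape_eq_0 m_def)
    then have "reads 9 (\<lambda>_. int t) (C t) 0 \<noteq> 0 \<or> reads 9 (\<lambda>_. int t) (C t) 1 \<noteq> 0"
      by (simp add: reads_def C_def T_def)
    moreover have "exec 9 ?body (\<lambda>_. int t) (C t) 1 (\<lambda>_. int (Suc t)) (C (Suc t))"
      by (rule exec_ActI) (auto simp: C_def T_def reads_def fun_eq_iff)
    moreover have "exec 9 ?loop (\<lambda>_. int (Suc t)) (C (Suc t)) (2 * d + 1) (\<lambda>_. int m) (C m)"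
      by (rule Suc.IH) (use Suc.prems in simp)
    ultimately have "exec 9 ?loop (\<lambda>_. int t) (C t) (1 + 1 + (2 * d + 1)) (\<lambda>_. int m) (C m)"
      by (rule exec_While_True)
    then show ?case
      by simp
  qed
  have Cm: "C m = T"
    using XU(3,4) by (auto simp: C_def T_def fun_eq_iff)
  have 3: "exec 9 ?loop (\<lambda>_. 0) (C 0) (2 * m + 1) (\<lambda>_. int m) T"
    using 2[of 0 m] unfolding Cm by (simp only: of_nat_0 add_0)
  have "hoare 9 T (\<lambda>h. h = (\<lambda>_. int m - int 0)) ?back (m * (1 + 1) + 1) (\<lambda>h. h = (\<lambda>_. int m - int m))"
    by (intro hoare_While hoare_Go) (auto simp: reads_T fun_eq_iff)
  then obtain t where t: "t \<le> m * 2 + 1" "exec 9 ?back (\<lambda>_. int m) T t (\<lambda>_. 0) T"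
    by (auto simp: hoare_def mult_2_right)
  have "exec 9 copy_com (\<lambda>_. 0) (init_tapes x u) (1 + (2 * m + 1 + t)) (\<lambda>_. 0) T"
    unfolding copy_com_def by (rule exec_Seq[OF 1 exec_Seq[OF 3 t(2)]])
  moreover have "1 + (2 * m + 1 + t) \<le> 4 * (length x + length u) + 3"
    using t(1) by (simp add: m_def)
  ultimately show ?thesis
    by blast
qed

lemma main_time_bound:
  assumes "n \<le> s" "k \<le> s" "len \<le> s"
  shows "setup_time + ((len * (block_time + 1) + 1) + final_time) \<le> 15 * s ^ 3 + 44 * s\<^sup>2 + 68 * s + 36"
proof -
  have nn: "n * n \<le> s * s"
    using assms by (intro mult_mono) auto
  have b: "block_time \<le> 15 * (s * s) + 29 * s + 16"
    using nn assms by (simp add: block_time_def for_time_def algebra_simps)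
  have "setup_time \<le> 10 * (s * s) + 33 * s + 23"
    using nn assms by (simp add: setup_time_def for_time_def algebra_simps)
  moreover have "final_time \<le> 5 * (s * s) + 18 * s + 12"
    using nn assms by (simp add: final_time_def for_time_def algebra_simps)
  moreover have "len * (block_time + 1) \<le> s * (15 * (s * s) + 29 * s + 17)"
    using b assms by (intro mult_mono) auto
  ultimately show ?thesis
    by (simp add: power2_eq_square power3_eq_cube algebra_simps)
qed

text \<open>The polynomial is that of \<open>main_time_bound\<close> plus \<open>4 * s + 3\<close>
  for copying and the 2 steps added by \<open>machine\<close>.\<close>

lemma exec_verifier:
  assumes "X = snd (input_tape x)" "U = snd (input_tape u)"
    and "n \<le> length x" "k \<le> length x" "len = length u"
  shows "\<exists>t h. exec 9 (copy_com ;; main_com) (\<lambda>_. 0) (init_tapes x u) t h T \<and>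
    t + 2 \<le> poly [:41, 72, 44, 15:] (length x + length u) \<and> (reads 9 h T 7 = 1 \<longleftrightarrow> accepted)"
proof -
  define s where "s = length x + length u"
  obtain t where t: "t \<le> 4 * s + 3" "exec 9 copy_com (\<lambda>_. 0) (init_tapes x u) t (\<lambda>_. 0) T"
    using exec_copy[OF assms(1,2)] by (auto simp: s_def)
  obtain t' h where t': "t' \<le> setup_time + ((len * (block_time + 1) + 1) + final_time)"
    "exec 9 main_com (\<lambda>_. 0) T t' h T" "h 7 = 0 \<longleftrightarrow> accepted"
    using hoare_main unfolding hoare_def by blast
  have "t' \<le> 15 * s ^ 3 + 44 * s\<^sup>2 + 68 * s + 36"
    using t'(1) main_time_bound[of s] assms by (simp add: s_def)
  then have "t + t' + 2 \<le> poly [:41, 72, 44, 15:] s"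
    using t(1) by (simp add: power2_eq_square power3_eq_cube algebra_simps)
  then show ?thesis
    using exec_Seq[OF t(2) t'(2)] t'(3) unfolding s_def
    by (intro exI[of _ "t + t'"] exI[of _ h]) (simp add: reads_T)
qed

end

section \<open>Reading the parameters off an arbitrary string\<close>

definition ones :: "bool list \<Rightarrow> nat" where
  "ones x = length (takeWhile id x)"

lemma nth_ones: "i < ones x \<Longrightarrow> i < length x \<and> x ! i"
  unfolding ones_def
  by (metis id_apply length_takeWhile_le nth_mem order_less_le_trans set_takeWhileD takeWhile_nth)

lemma ones_end: "ones x < length x \<Longrightarrow> \<not> x ! ones x"
  unfolding ones_def using nth_length_takeWhile[of id x] by simp

lemma ones_le: "ones x \<le> length x"
  unfolding ones_def by (rule length_takeWhile_le)

abbreviation nvertices :: "bool list \<Rightarrow> nat" where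
  "nvertices x \<equiv> ones x"

abbreviation njumps :: "bool list \<Rightarrow> nat" where
  "njumps x \<equiv> ones (drop (Suc (ones x)) x)"

text \<open>A run of ones ends with \<open>False\<close> or at the end of the string, where the tape
  is blank; neither reads as 2.\<close>

lemma scan_input_tape:
  "scan (snd (input_tape x)) (snd (input_tape u)) (nvertices x) (njumps x) (length u)"
proof
  fix p :: int
  assume "0 \<le> p" "p < int (nvertices x)"
  then show "snd (input_tape x) p = 2"
    using nth_ones[of "nat p" x] by (simp add: input_tape_nth nat_less_iff)
next
  show "snd (input_tape x) (int (nvertices x)) \<noteq> 2"
    using ones_end[of x] by (auto simp: input_tape_nth)
next
  show "snd (input_tape x) (- 1) \<noteq> 2"
    by (simp add: input_tape_nth)
next
  fix p :: int
  assume p: "int (nvertices x) < p" "p \<le> int (nvertices x) + int (njumps x)"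
  define i where "i = nat (p - int (nvertices x) - 1)"
  have i: "p = int (Suc (nvertices x) + i)" "i < njumps x"
    using p by (auto simp: i_def)
  then have "Suc (nvertices x) + i < length x" "x ! (Suc (nvertices x) + i)"
    using nth_ones[OF i(2)] by auto
  then show "snd (input_tape x) p = 2"
    unfolding i(1) input_tape_nth nat_int by simp
next
  let ?i = "Suc (nvertices x) + njumps x"
  have "\<not> (?i < length x \<and> x ! ?i)"
    using ones_end[of "drop (Suc (nvertices x)) x"] by auto
  then have "snd (input_tape x) (int ?i) \<noteq> 2"
    unfolding input_tape_nth nat_int by simp
  then show "snd (input_tape x) (int (nvertices x) + int (njumps x) + 1) \<noteq> 2"
    by (simp add: algebra_simps)
next
  fix p :: int
  assume "int (length u) \<le> p"
  then show "snd (input_tape u) p = 0"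
    by (simp add: input_tape_eq_0)
qed

definition valid_certificate :: "bool list \<Rightarrow> bool list \<Rightarrow> bool" where
  "valid_certificate x u \<longleftrightarrow>
     scan.accepted (snd (input_tape x)) (snd (input_tape u)) (nvertices x) (njumps x)"

lemma certificate_language_NP:
  fixes p :: "nat poly"
  shows "{x. \<exists>u. length u \<le> poly p (length x) \<and> valid_certificate x u} \<in> NP"
proof (rule NP_machine[where K = 9 and S = 3 and c = "copy_com ;; main_com" and acc = "\<lambda>r. r 7 = 1"])
  show "com_wf 3 (copy_com ;; main_com)"
    by (rule com_wf_verifier)
  fix x u
  interpret scan "snd (input_tape x)" "snd (input_tape u)" "nvertices x" "njumps x" "length u"
    by (rule scan_input_tape)
  have "njumps x \<le> length x"
    using ones_le[of "drop (Suc (ones x)) x"] by simp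
  from exec_verifier[OF refl refl ones_le this refl] obtain t h where
    "exec 9 (copy_com ;; main_com) (\<lambda>_. 0) (init_tapes x u) t h T"
    "t + 2 \<le> poly [:41, 72, 44, 15:] (length x + length u)" "reads 9 h T 7 = 1 \<longleftrightarrow> accepted"
    by (elim exE conjE)
  then show "\<exists>t h T. exec 9 (copy_com ;; main_com) (\<lambda>_. 0) (init_tapes x u) t h T \<and>
      t + 2 \<le> poly [:41, 72, 44, 15:] (length x + length u) \<and>
      (reads 9 h T 7 = 1 \<longleftrightarrow> valid_certificate x u)"
    unfolding valid_certificate_def by (intro exI conjI)
qed auto

section \<open>Correctness on encoded instances\<close>

text \<open>Row-major indexing, used for the adjacency matrix and for the blocks of the certificate
  alike.\<close>

lemma nth_concat_map_upt:
  assumes "a < m" "b < n"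
  shows "concat (map (\<lambda>u. map (f u) [0..<n]) [0..<m]) ! (a * n + b) = f a b"
  using assms(1)
proof (induction m)
  case (Suc m)
  let ?xs = "concat (map (\<lambda>u. map (f u) [0..<n]) [0..<m])"
  have len: "length ?xs = m * n"
    by (simp add: length_concat o_def sum_list_triv)
  have "?xs @ map (f m) [0..<n] = concat (map (\<lambda>u. map (f u) [0..<n]) [0..<Suc m])"
    by simp
  moreover have "(?xs @ map (f m) [0..<n]) ! (a * n + b) = f a b"
  proof (cases "a < m")
    case True
    then have "Suc a * n \<le> m * n"
      by (intro mult_right_mono) auto
    then have "a * n + b < m * n"
      using assms(2) by simp
    then show ?thesis
      using Suc.IH[OF True] len by (simp add: nth_append)
  next
    case False
    then have "a = m"
      using Suc.prems by simp
    then show ?thesis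
      using assms(2) len by (simp add: nth_append)
  qed
  ultimately show ?case
    by simp
qed simp

lemma length_concat_map_upt: "length (concat (map (\<lambda>u. map (f u) [0..<n]) [0..<m])) = m * n"
  by (simp add: length_concat o_def sum_list_triv)

lemma ones_unary: "ones (unary m @ xs) = m"
  by (simp add: ones_def unary_def takeWhile_append takeWhile_replicate)

lemma input_tape_of_nat:
  "snd (input_tape x) (int i) = (if i < length x then if x ! i then 2 else 1 else 0)"
  by (simp add: input_tape_nth)

text \<open>With \<open>0 < nverts I\<close> the end of the certificate determines the number of
  blocks; on the instances of the theorem this follows from \<open>k \<ge> 1\<close>.\<close>

locale isr_encoding =
  fixes I :: isr
  assumes inst: "isr_instance I" and nverts_pos: "0 < nverts I"
begin

abbreviation "n \<equiv> nverts I"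
abbreviation "x \<equiv> isr_encode I"

definition matrix :: "bool list" where
  "matrix = concat (map (\<lambda>u. map (\<lambda>v. {u, v} \<in> edges I) [0..<n]) [0..<n])"

lemma encode: "x = unary n @ unary (jumps I) @ matrix @ map (\<lambda>v. v \<in> source I) [0..<n] @
    map (\<lambda>v. v \<in> target I) [0..<n]"
  by (simp add: isr_encode_def matrix_def)

lemma nvertices: "nvertices x = n"
  unfolding encode by (rule ones_unary)

lemma njumps: "ones (drop (Suc n) x) = jumps I"
proof -
  have "drop (Suc n) x = unary (jumps I) @ matrix @ map (\<lambda>v. v \<in> source I) [0..<n] @
      map (\<lambda>v. v \<in> target I) [0..<n]"
    unfolding encode by (simp add: unary_def)
  then show ?thesis
    by (simp only: ones_unary)
qed

lemma n_le_length: "n \<le> length x"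
  by (simp add: encode unary_def)

lemma nth_encode:
  "i < n * n + n + n \<Longrightarrow> snd (input_tape x) (int n + int (jumps I) + 2 + int i) = 2 \<longleftrightarrow>
    (matrix @ map (\<lambda>v. v \<in> source I) [0..<n] @ map (\<lambda>v. v \<in> target I) [0..<n]) ! i"
proof -
  let ?pre = "unary n @ unary (jumps I)" and
    ?post = "matrix @ map (\<lambda>v. v \<in> source I) [0..<n] @ map (\<lambda>v. v \<in> target I) [0..<n]"
  assume "i < n * n + n + n"
  then have i: "i < length ?post"
    by (simp add: matrix_def length_concat_map_upt)
  have x: "x = ?pre @ ?post"
    by (simp add: encode)
  have pre: "int n + int (jumps I) + 2 + int i = int (length ?pre + i)"
    by (simp add: unary_def)
  have "snd (input_tape x) (int (length ?pre + i)) = 2 \<longleftrightarrow> (?pre @ ?post) ! (length ?pre + i)"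
    unfolding input_tape_nth nat_int x using i by (simp only: length_append) simp
  then show ?thesis
    unfolding pre by (simp only: nth_append_length_plus)
qed

context
  fixes u :: "bool list"
begin

interpretation scan "snd (input_tape x)" "snd (input_tape u)" n "jumps I" "length u"
  using scan_input_tape[of x u] unfolding nvertices njumps .

lemma edge_iff:
  assumes "a < n" "b < n"
  shows "edge a b \<longleftrightarrow> {a, b} \<in> edges I"
proof -
  have "Suc a * n \<le> n * n"
    using assms by (intro mult_right_mono) auto
  then have i: "a * n + b < n * n"
    using assms by simp
  have "edge a b \<longleftrightarrow> snd (input_tape x) (int n + int (jumps I) + 2 + int (a * n + b)) = 2"
    by (simp add: edge_def m0_def algebra_simps)
  also have "\<dots> \<longleftrightarrow> matrix ! (a * n + b)"
    using i nth_encode[of "a * n + b"] by (simp add: nth_append matrix_def length_concat_map_upt)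
  also have "\<dots> \<longleftrightarrow> {a, b} \<in> edges I"
    unfolding matrix_def using nth_concat_map_upt[OF assms] .
  finally show ?thesis .
qed

lemma source_ok_iff: "source_ok \<longleftrightarrow> S 0 = source I"
proof -
  have "source I \<subseteq> {..<n}"
    using inst by (simp add: isr_instance_def indep_set_def)
  moreover have "snd (input_tape x) (m0 + int n * int n + int v) = 2 \<longleftrightarrow> v \<in> source I" if "v < n" for v
    using nth_encode[of "n * n + v"] that
    by (simp add: m0_def nth_append matrix_def length_concat_map_upt algebra_simps)
  moreover have "S 0 \<subseteq> {..<n}"
    by (auto simp: S_def)
  ultimately show ?thesis
    unfolding source_ok_def by blast
qed

lemma target_ok_iff: "target_ok j \<longleftrightarrow> S j = target I"
proof -
  have "target I \<subseteq> {..<n}"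
    using inst by (simp add: isr_instance_def indep_set_def)
  moreover have "snd (input_tape x) (m0 + int n * int n + int n + int v) = 2 \<longleftrightarrow> v \<in> target I"
    if "v < n" for v
    using nth_encode[of "n * n + n + v"] that
    by (simp add: m0_def nth_append matrix_def length_concat_map_upt algebra_simps)
  moreover have "S j \<subseteq> {..<n}"
    by (auto simp: S_def)
  ultimately show ?thesis
    unfolding target_ok_def by blast
qed

lemma good_iff:
  "good j \<longleftrightarrow> indep_set (verts I) (edges I) (S j) \<and> TJ_adjacent (jumps I) (S j) (S (Suc j))"
proof -
  have fin: "finite (S i)" for i
    by (simp add: S_def)
  have "(\<forall>a<n. \<forall>b<n. \<not> conflict j a b) \<longleftrightarrow> indep_set (verts I) (edges I) (S j)"
    using edge_iff by (auto simp: conflict_def indep_set_def S_def)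
  moreover have "card (S j - S (Suc j)) = card (S (Suc j) - S j) \<longleftrightarrow> card (S j) = card (S (Suc j))"
  proof -
    have "card (S j) = card (S j \<inter> S (Suc j)) + card (S j - S (Suc j))"
      using fin card_mono[of "S j" "S j \<inter> S (Suc j)"] by (simp add: card_Diff_subset_Int)
    moreover have "card (S (Suc j)) = card (S j \<inter> S (Suc j)) + card (S (Suc j) - S j)"
      using fin card_mono[of "S (Suc j)" "S j \<inter> S (Suc j)"]
      by (simp add: card_Diff_subset_Int Int_commute)
    ultimately show ?thesis
      by linarith
  qed
  moreover have "TJ_adjacent (jumps I) (S j) (S (Suc j)) \<longleftrightarrow>
      card (S j) = card (S (Suc j)) \<and> card (S j - S (Suc j)) \<le> jumps I"
  proof (cases "card (S j) = card (S (Suc j))")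
    case True
    then show ?thesis
      using TJ_adjacent_iff_card_Diff[OF fin fin] by simp
  qed (simp add: TJ_adjacent_def)
  ultimately show ?thesis
    unfolding good_def by blast
qed

text \<open>No \<open>good\<close> clause tests \<open>S blocks\<close>; its independence comes from
  its being the target of an instance.\<close>

lemma accepted_imp_yes:
  assumes accepted
  shows "isr_yes I"
proof -
  have good: "good j" if "j < blocks" for j
    using assms that by (simp add: accepted_def)
  have ends: "S 0 = source I" "S blocks = target I"
    using assms by (auto simp: accepted_def source_ok_iff target_ok_iff)
  have "indep_set (verts I) (edges I) (S i)" if "i \<le> blocks" for i
    using that good[of i] good_iff ends inst
    by (cases "i = blocks") (auto simp: isr_instance_def)
  moreover have "TJ_adjacent (jumps I) (S (i - 1)) (S i)" if "i \<in> {1..blocks}" for i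
    using good[of "i - 1"] good_iff[of "i - 1"] that by (cases i) auto
  ultimately show ?thesis
    unfolding isr_yes_def TJ_reconfigurable_def using ends
    by (intro exI[of _ blocks] exI[of _ S]) simp
qed

lemma certificate_accepted:
  fixes A :: "nat \<Rightarrow> nat set"
  assumes u: "u = concat (map (\<lambda>j. map (\<lambda>v. v \<in> A j) [0..<n]) [0..<Suc l])"
    and A: "A 0 = source I" "A l = target I"
      "\<And>i. i < l \<Longrightarrow> (A i, A (Suc i)) \<in> TJ_rel (verts I) (edges I) (jumps I)"
  shows accepted
proof -
  have sub: "A j \<subseteq> {..<n}" if "j \<le> l" for j
  proof (cases "j = l")
    case True
    then show ?thesis
      using A(2) inst by (simp add: isr_instance_def indep_set_def)
  next
    case False
    then show ?thesis
      using A(3)[of j] that by (auto simp: TJ_rel_def indep_set_def)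
  qed
  have len: "length u = Suc l * n"
    unfolding u by (rule length_concat_map_upt)
  have SA: "S j = A j" if "j \<le> l" for j
  proof -
    have "snd (input_tape u) (int j * int n + int v) = 2 \<longleftrightarrow> v \<in> A j" if "v < n" for v
    proof -
      have "Suc j * n \<le> Suc l * n"
        using \<open>j \<le> l\<close> by (intro mult_right_mono) auto
      then have i: "j * n + v < length u"
        using that len unfolding mult_Suc by linarith
      have *: "int j * int n + int v = int (j * n + v)"
        by simp
      have "snd (input_tape u) (int j * int n + int v) = 2 \<longleftrightarrow> u ! (j * n + v)"
        unfolding * input_tape_of_nat using i by (simp only: if_True) simp
      also have "\<dots> \<longleftrightarrow> v \<in> A j"
        unfolding u using nth_concat_map_upt[of j "Suc l" v n] that \<open>j \<le> l\<close> by simp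
      finally show ?thesis .
    qed
    then show ?thesis
      using sub[OF that] by (auto simp: S_def)
  qed
  \<comment> \<open>\<open>u\<close> consists of \<open>Suc l\<close> blocks of positive length, so
    block \<open>Suc l\<close>, counted from 0, is the first to begin on a blank.\<close>
  have end_iff: "snd (input_tape u) (int (Suc j) * int n) = 0 \<or> n = 0 \<longleftrightarrow> l \<le> j" for j
  proof -
    have "int (length u) \<le> int (Suc j) * int n \<longleftrightarrow> Suc l * n \<le> Suc j * n"
      unfolding len by (simp only: of_nat_le_iff flip: of_nat_mult)
    also have "\<dots> \<longleftrightarrow> l \<le> j"
      using nverts_pos by simp
    finally have "int (length u) \<le> int (Suc j) * int n \<longleftrightarrow> l \<le> j" .
    moreover have "\<not> int (Suc j) * int n < 0"
      by (simp add: not_less)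
    moreover have "n \<noteq> 0"
      using nverts_pos by simp
    ultimately show ?thesis
      unfolding input_tape_eq_0 by blast
  qed
  have blocks: "blocks = l"
    unfolding blocks_def end_iff by (rule Least_equality) auto
  have "good i" if "i < l" for i
    unfolding good_iff using A(3)[OF that] SA[of i] SA[of "Suc i"] that by (simp add: TJ_rel_def)
  then show ?thesis
    unfolding accepted_def blocks source_ok_iff target_ok_iff using SA A(1,2) by simp
qed

lemmas valid_iff = valid_certificate_def[of x u, unfolded nvertices njumps]
lemmas valid_imp_yes = accepted_imp_yes[folded valid_iff]
lemmas certificate_valid = certificate_accepted[folded valid_iff]

end

end

theorem theorem4:
  fixes c :: nat and d g :: "nat \<Rightarrow> real"
  assumes "d \<in> o(\<lambda>n. real n / ln (real n))"
    and "g \<in> O(\<lambda>m. ln (real m))"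
  shows "problem_in_NP isr_encode
    {X. isr_instance X \<and>
        chromatic_number (verts X) (edges X) \<le> c \<and>
        real (max_degree (verts X) (edges X)) \<le> d (nverts X) \<and>
        (\<exists>\<mu>. real \<mu> \<le> g (card (source X)) \<and>
              int (jumps X) = int (card (source X)) - int \<mu> \<and> jumps X \<ge> 1)}
    isr_yes"
proof -
  obtain l0 where l0: "\<And>n E I J k \<mu>. simple_graph {..<n} E \<Longrightarrow> chromatic_number {..<n} E \<le> c \<Longrightarrow>
    real (max_degree {..<n} E) \<le> d n \<Longrightarrow> indep_set {..<n} E I \<Longrightarrow> indep_set {..<n} E J \<Longrightarrow>
    card I = card J \<Longrightarrow> real \<mu> \<le> g (card I) \<Longrightarrow> card I = k + \<mu> \<Longrightarrow> 1 \<le> k \<Longrightarrow>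
    TJ_reconfigurable {..<n} E k I J \<Longrightarrow> (I, J) \<in> TJ_rel {..<n} E k ^^ l0"
    using short_sequence[OF assms] by blast
  \<comment> \<open>A sequence of \<open>l0\<close> steps has \<open>Suc l0\<close> blocks of
    \<open>nverts X\<close> bits, and \<open>nverts X\<close> is at most the length of the
    encoding.\<close>
  define p :: "nat poly" where "p = [:0, Suc l0:]"
  define L where "L = {x. \<exists>u. length u \<le> poly p (length x) \<and> valid_certificate x u}"
  have "isr_encode X \<in> L \<longleftrightarrow> isr_yes X"
    if X: "isr_instance X" "chromatic_number (verts X) (edges X) \<le> c"
      "real (max_degree (verts X) (edges X)) \<le> d (nverts X)"
      and \<mu>: "real \<mu> \<le> g (card (source X))" "int (jumps X) = int (card (source X)) - int \<mu>" "jumps X \<ge> 1"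
    for X \<mu>
  proof -
    have card: "card (source X) = jumps X + \<mu>"
      using \<mu>(2) by linarith
    have "source X \<subseteq> {..<nverts X}"
      using X(1) by (simp add: isr_instance_def indep_set_def)
    then have "card (source X) \<le> nverts X"
      using card_mono[of "{..<nverts X}"] by simp
    then interpret isr_encoding X
      using X(1) card \<mu>(3) by unfold_locales auto
    show ?thesis
    proof
      assume "isr_encode X \<in> L"
      then show "isr_yes X"
        using valid_imp_yes by (auto simp: L_def)
    next
      assume "isr_yes X"
      then have "(source X, target X) \<in> TJ_rel (verts X) (edges X) (jumps X) ^^ l0"
        unfolding isr_yes_def using X card \<mu> by (intro l0) (auto simp: isr_instance_def)
      then obtain A where A: "A 0 = source X" "A l0 = target X"
        "\<And>i. i < l0 \<Longrightarrow> (A i, A (Suc i)) \<in> TJ_rel (verts X) (edges X) (jumps X)"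
        unfolding relpow_fun_conv by blast
      define u where "u = concat (map (\<lambda>j. map (\<lambda>v. v \<in> A j) [0..<nverts X]) [0..<Suc l0])"
      have "length u = Suc l0 * nverts X"
        unfolding u_def by (rule length_concat_map_upt)
      also have "\<dots> \<le> poly p (length (isr_encode X))"
        using mult_right_mono[OF n_le_length, of "Suc l0"] by (simp add: p_def mult.commute)
      finally show "isr_encode X \<in> L"
        using certificate_valid[OF u_def A] unfolding L_def by blast
    qed
  qed
  moreover have "L \<in> NP"
    unfolding L_def by (rule certificate_language_NP)
  ultimately show ?thesis
    unfolding problem_in_NP_def by (intro bexI[of _ L]) auto
qed

end
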